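(* Every binary cone-expansion $T$ of $\mathsf{DMT}$ is weakly binary: whenever $\mathfrak U$ is a monster model of $T$ and $a,b$ are finite tuples (in an elementary extension of $\mathfrak U$) such that $\operatorname{tp}(a/\mathfrak U)$ and $\operatorname{tp}(b/\mathfrak U)$ are invariant, there is a small $A\subseteq\mathfrak U$ such that $$\operatorname{tp}(a/\mathfrak U)\cup\operatorname{tp}(b/\mathfrak U)\cup\operatorname{tp}(a,b/A)\vdash\operatorname{tp}(a,b/\mathfrak U).$$
   Context: A meet-tree is a structure $(M,<,\sqcap)$ where $<$ is a partial order such that for every $a$ the set $\{x: x<a\}$ is linearly ordered, and any two elements have a greatest common lower bound (meet) $\sqcap$. $\mathsf{DMT}$ is the theory of meet-trees such that for every $a$, $\{x:x<a\}$ is a dense linear order without endpoints and there are infinitely many open cones above $a$, the open cones above $g$ being the classes of the equivalence relation $x\sqcap y>g$ on $\{x:x>g\}$. Write $x\parallel y$ for "$x\not\le y$ and $y\not\le x$". Let $L_{\mathrm{mt}}=\{<,\sqcap\}$. A binary cone-expansion of $\mathsf{DMT}$ is a theory $T$ in a language $L=L_{\mathrm{mt}}\cup\{R_j,P_{j'}: j\in J, j'\in J'\}$ where each $P_{j'}$ is a unary and each $R_j$ a binary relation symbol, such that $T$ is a completion of $\mathsf{DMT}$, $T$ eliminates quantifiers in $L$, and each $R_j$ is on open cones: $R_j(x,y)\to x\parallel y$, and if $x\parallel y$, $x\sqcap x'>x\sqcap y$ and $y\sqcap y'>x\sqcap y$ then $R_j(x,y)\leftrightarrow R_j(x',y')$.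 A monster model is a $\kappa$-saturated, $\kappa$-strongly homogeneous model for a large cardinal $\kappa$; small means of size $<\kappa$. A global type $p(x)\in S(\mathfrak U)$ is invariant if for some small $A\subseteq\mathfrak U$, for every formula $\varphi(x;y)$ and all $c\equiv_A c'$ in $\mathfrak U$, $p\vdash\varphi(x;c)\leftrightarrow\varphi(x;c')$. *)

theory Defs
  imports Main
begin

unbundle cardinal_syntax

section \<open>Formulas over the languages with parameters\<close>

text \<open>
  A language is given by the two index sets \<open>J :: 'j set\<close> (binary relation symbols) and
  \<open>K :: 'k set\<close> (unary predicate symbols), either of which may be empty; the symbols \<open><\<close> and
  \<open>\<sqinter>\<close> are always present. The type \<open>'c\<close> supplies names for parameters (new constant symbols).
  The parameters, relation symbols and predicate symbols occurring in a formula are collected by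
  the set functions \<open>pars\<close>, \<open>rels\<close>, \<open>prds\<close> of the datatype.
\<close>

datatype (pars_tm: 'c) tm =
    Var nat
  | Par 'c
  | Mt "'c tm" "'c tm"  (infixl "\<^bold>\<sqinter>" 80)

datatype (pars: 'c, rels: 'j, prds: 'k) fm =
    Fls
  | Eq "'c tm" "'c tm"  (infix "\<^bold>=" 70)
  | Lt "'c tm" "'c tm"  (infix "\<^bold><" 70)
  | Rel 'j "'c tm" "'c tm"
  | Prd 'k "'c tm"
  | Imp "('c, 'j, 'k) fm" "('c, 'j, 'k) fm"  (infixr "\<^bold>\<rightarrow>" 55)
  | Forall nat "('c, 'j, 'k) fm"

abbreviation Neg where "Neg \<phi> \<equiv> \<phi> \<^bold>\<rightarrow> Fls"
abbreviation Or  (infixr "\<^bold>\<or>" 60) where "\<phi> \<^bold>\<or> \<psi> \<equiv> Neg \<phi> \<^bold>\<rightarrow> \<psi>"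
abbreviation And  (infixr "\<^bold>\<and>" 65) where "\<phi> \<^bold>\<and> \<psi> \<equiv> Neg (\<phi> \<^bold>\<rightarrow> Neg \<psi>)"
abbreviation Iff  (infix "\<^bold>\<leftrightarrow>" 50) where "\<phi> \<^bold>\<leftrightarrow> \<psi> \<equiv> (\<phi> \<^bold>\<rightarrow> \<psi>) \<^bold>\<and> (\<psi> \<^bold>\<rightarrow> \<phi>)"
abbreviation Exists where "Exists n \<phi> \<equiv> Neg (Forall n (Neg \<phi>))"
abbreviation Le  (infix "\<^bold>\<le>" 70) where "s \<^bold>\<le> t \<equiv> s \<^bold>< t \<^bold>\<or> s \<^bold>= t"
abbreviation Incomparable  (infix "\<^bold>\<parallel>" 70) where "s \<^bold>\<parallel> t \<equiv> Neg (s \<^bold>\<le> t) \<^bold>\<and> Neg (t \<^bold>\<le> s)"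
abbreviation Conjs where "Conjs \<phi>s \<equiv> foldr And \<phi>s (Neg Fls)"
abbreviation Alls where "Alls ns \<phi> \<equiv> foldr Forall ns \<phi>"
abbreviation Exs where "Exs ns \<phi> \<equiv> foldr Exists ns \<phi>"

fun fv_tm :: "'c tm \<Rightarrow> nat set" where
  "fv_tm (Var n) = {n}"
| "fv_tm (Par c) = {}"
| "fv_tm (s \<^bold>\<sqinter> t) = fv_tm s \<union> fv_tm t"

fun fv :: "('c, 'j, 'k) fm \<Rightarrow> nat set" where
  "fv Fls = {}"
| "fv (s \<^bold>= t) = fv_tm s \<union> fv_tm t"
| "fv (s \<^bold>< t) = fv_tm s \<union> fv_tm t"
| "fv (Rel j s t) = fv_tm s \<union> fv_tm t"
| "fv (Prd k t) = fv_tm t"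
| "fv (\<phi> \<^bold>\<rightarrow> \<psi>) = fv \<phi> \<union> fv \<psi>"
| "fv (Forall n \<phi>) = fv \<phi> - {n}"

fun qfree :: "('c, 'j, 'k) fm \<Rightarrow> bool" where
  "qfree (\<phi> \<^bold>\<rightarrow> \<psi>) \<longleftrightarrow> qfree \<phi> \<and> qfree \<psi>"
| "qfree (Forall n \<phi>) \<longleftrightarrow> False"
| "qfree _ \<longleftrightarrow> True"

text \<open>\<open>Fm J K A\<close> is the set of L(A)-formulas; L-formulas are obtained for \<open>A = {}\<close>.\<close>

definition Fm :: "'j set \<Rightarrow> 'k set \<Rightarrow> 'c set \<Rightarrow> ('c, 'j, 'k) fm set" where
  "Fm J K A = {\<phi>. rels \<phi> \<subseteq> J \<and> prds \<phi> \<subseteq> K \<and> pars \<phi> \<subseteq> A}"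

definition Sent :: "'j set \<Rightarrow> 'k set \<Rightarrow> 'c set \<Rightarrow> ('c, 'j, 'k) fm set" where
  "Sent J K A = {\<phi> \<in> Fm J K A. fv \<phi> = {}}"

definition univ_closure :: "('c, 'j, 'k) fm \<Rightarrow> ('c, 'j, 'k) fm" where
  "univ_closure \<phi> = Alls (sorted_list_of_set (fv \<phi>)) \<phi>"

text \<open>
  Replacing free variables by parameters. For \<open>\<phi>(x;y)\<close> with \<open>y\<close> the list of variables \<open>ys\<close>,
  \<open>plug ys c \<phi>\<close> is \<open>\<phi>(x;c)\<close>.
\<close>

fun inst_tm :: "(nat \<Rightarrow> 'c option) \<Rightarrow> 'c tm \<Rightarrow> 'c tm" where
  "inst_tm \<sigma> (Var n) = (case \<sigma> n of None \<Rightarrow> Var n | Some c \<Rightarrow> Par c)"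
| "inst_tm \<sigma> (Par c) = Par c"
| "inst_tm \<sigma> (s \<^bold>\<sqinter> t) = inst_tm \<sigma> s \<^bold>\<sqinter> inst_tm \<sigma> t"

fun inst :: "(nat \<Rightarrow> 'c option) \<Rightarrow> ('c, 'j, 'k) fm \<Rightarrow> ('c, 'j, 'k) fm" where
  "inst \<sigma> Fls = Fls"
| "inst \<sigma> (s \<^bold>= t) = (inst_tm \<sigma> s \<^bold>= inst_tm \<sigma> t)"
| "inst \<sigma> (s \<^bold>< t) = (inst_tm \<sigma> s \<^bold>< inst_tm \<sigma> t)"
| "inst \<sigma> (Rel j s t) = Rel j (inst_tm \<sigma> s) (inst_tm \<sigma> t)"
| "inst \<sigma> (Prd k t) = Prd k (inst_tm \<sigma> t)"
| "inst \<sigma> (\<phi> \<^bold>\<rightarrow> \<psi>) = inst \<sigma> \<phi> \<^bold>\<rightarrow> inst \<sigma> \<psi>"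
| "inst \<sigma> (Forall n \<phi>) = Forall n (inst (\<sigma>(n := None)) \<phi>)"

definition plug :: "nat list \<Rightarrow> 'c list \<Rightarrow> ('c, 'j, 'k) fm \<Rightarrow> ('c, 'j, 'k) fm" where
  "plug ys c \<phi> = inst (map_of (zip ys c)) \<phi>"


section \<open>Structures, satisfaction, entailment\<close>

record ('m, 'j, 'k) struct =
  carrier :: "'m set"
  lt :: "'m \<Rightarrow> 'm \<Rightarrow> bool"
  mt :: "'m \<Rightarrow> 'm \<Rightarrow> 'm"
  rel :: "'j \<Rightarrow> 'm \<Rightarrow> 'm \<Rightarrow> bool"
  prd :: "'k \<Rightarrow> 'm \<Rightarrow> bool"

definition is_struct :: "('m, 'j, 'k) struct \<Rightarrow> bool" where
  "is_struct M \<longleftrightarrow> carrier M \<noteq> {} \<and> (\<forall>x\<in>carrier M. \<forall>y\<in>carrier M. mt M x y \<in> carrier M)"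

text \<open>\<open>\<iota>\<close> interprets the parameters and \<open>s\<close> the variables.\<close>

fun val :: "('m, 'j, 'k) struct \<Rightarrow> ('c \<Rightarrow> 'm) \<Rightarrow> (nat \<Rightarrow> 'm) \<Rightarrow> 'c tm \<Rightarrow> 'm" where
  "val M \<iota> s (Var n) = s n"
| "val M \<iota> s (Par c) = \<iota> c"
| "val M \<iota> s (t \<^bold>\<sqinter> u) = mt M (val M \<iota> s t) (val M \<iota> s u)"

fun sat :: "('m, 'j, 'k) struct \<Rightarrow> ('c \<Rightarrow> 'm) \<Rightarrow> (nat \<Rightarrow> 'm) \<Rightarrow> ('c, 'j, 'k) fm \<Rightarrow> bool" where
  "sat M \<iota> s Fls \<longleftrightarrow> False"
| "sat M \<iota> s (t \<^bold>= u) \<longleftrightarrow> val M \<iota> s t = val M \<iota> s u"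
| "sat M \<iota> s (t \<^bold>< u) \<longleftrightarrow> lt M (val M \<iota> s t) (val M \<iota> s u)"
| "sat M \<iota> s (Rel j t u) \<longleftrightarrow> rel M j (val M \<iota> s t) (val M \<iota> s u)"
| "sat M \<iota> s (Prd k t) \<longleftrightarrow> prd M k (val M \<iota> s t)"
| "sat M \<iota> s (\<phi> \<^bold>\<rightarrow> \<psi>) \<longleftrightarrow> (sat M \<iota> s \<phi> \<longrightarrow> sat M \<iota> s \<psi>)"
| "sat M \<iota> s (Forall n \<phi>) \<longleftrightarrow> (\<forall>x\<in>carrier M. sat M \<iota> (s(n := x)) \<phi>)"

text \<open>
  Semantic consequence; free variables behave like additional constants. HOL has no quantifier
  over all types, so the structures range over one fixed type, that of the formulas themselves.
  Its cardinality is infinite and at least the number of formulas, variables and parameters, hence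
  by the downward Loewenheim-Skolem theorem every counterexample to \<open>\<Sigma> \<turnstile> \<phi>\<close>, over whatever type,
  yields a counterexample over this type.
\<close>

definition entails :: "('c, 'j, 'k) fm set \<Rightarrow> ('c, 'j, 'k) fm \<Rightarrow> bool"  (infix "\<turnstile>" 45) where
  "\<Sigma> \<turnstile> \<phi> \<longleftrightarrow>
    (\<forall>(M :: (('c, 'j, 'k) fm, 'j, 'k) struct) \<iota> s.
       is_struct M \<and> range \<iota> \<subseteq> carrier M \<and> range s \<subseteq> carrier M \<and> (\<forall>\<psi>\<in>\<Sigma>. sat M \<iota> s \<psi>)
       \<longrightarrow> sat M \<iota> s \<phi>)"


section \<open>The theory DMT and its binary cone-expansions\<close>

text \<open>
  The axiom \<open>cones_axiom n\<close> says that there are at least \<open>n\<close> open cones above every point: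
  \<open>n\<close> points above it, pairwise not equivalent for the relation of lying in the same open cone.
\<close>

definition cones_axiom :: "nat \<Rightarrow> ('c, 'j, 'k) fm" where
  "cones_axiom n =
     Forall 0 (Exs [1..<n + 1]
       (Conjs (map (\<lambda>i. Var 0 \<^bold>< Var i) [1..<n + 1]) \<^bold>\<and>
        Conjs (map (\<lambda>(i, j). Neg (Var 0 \<^bold>< Var i \<^bold>\<sqinter> Var j))
          [(i, j). j \<leftarrow> [1..<n + 1], i \<leftarrow> [1..<j]])))"

definition DMT :: "('c, 'j, 'k) fm set" where
  "DMT = (let x = Var 0; y = Var 1; z = Var 2 in
    {
     Forall 0 (Neg (x \<^bold>< x)),
     Alls [0, 1, 2] (x \<^bold>< y \<^bold>\<and> y \<^bold>< z \<^bold>\<rightarrow> x \<^bold>< z),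
     Alls [0, 1, 2] (x \<^bold>< z \<^bold>\<and> y \<^bold>< z \<^bold>\<rightarrow> x \<^bold>< y \<^bold>\<or> x \<^bold>= y \<^bold>\<or> y \<^bold>< x),
     Alls [0, 1] (x \<^bold>\<sqinter> y \<^bold>\<le> x \<^bold>\<and> x \<^bold>\<sqinter> y \<^bold>\<le> y),
     Alls [0, 1, 2] (z \<^bold>\<le> x \<^bold>\<and> z \<^bold>\<le> y \<^bold>\<rightarrow> z \<^bold>\<le> x \<^bold>\<sqinter> y),
     \<comment> \<open>the set of predecessors of each point is a nonempty dense order without endpoints\<close>
     Forall 0 (Exists 1 (y \<^bold>< x)),
     Alls [0, 1] (y \<^bold>< x \<^bold>\<rightarrow> Exists 2 (z \<^bold>< y)),
     Alls [0, 1] (y \<^bold>< x \<^bold>\<rightarrow> Exists 2 (y \<^bold>< z \<^bold>\<and> z \<^bold>< x)),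
     Alls [0, 1, 2] (y \<^bold>< z \<^bold>\<and> z \<^bold>< x \<^bold>\<rightarrow> Exists 3 (y \<^bold>< Var 3 \<^bold>\<and> Var 3 \<^bold>< z))
    } \<union> range cones_axiom)"

text \<open>
  Theories are taken to be deductively closed; for a complete theory, being consistent and
  containing each sentence or its negation makes \<open>\<sigma> \<in> T\<close> the same as \<open>T \<turnstile> \<sigma>\<close>.
\<close>

definition complete_theory :: "'j set \<Rightarrow> 'k set \<Rightarrow> ('c, 'j, 'k) fm set \<Rightarrow> bool" where
  "complete_theory J K T \<longleftrightarrow>
     T \<subseteq> Sent J K {} \<and> \<not> T \<turnstile> Fls \<and> (\<forall>\<sigma>\<in>Sent J K {}. \<sigma> \<in> T \<or> Neg \<sigma> \<in> T)"

definition eliminates_quantifiers :: "'j set \<Rightarrow> 'k set \<Rightarrow> ('c, 'j, 'k) fm set \<Rightarrow> bool" where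
  "eliminates_quantifiers J K T \<longleftrightarrow>
     (\<forall>\<phi>\<in>Fm J K {}. \<exists>\<psi>\<in>Fm J K {}.
        qfree \<psi> \<and> fv \<psi> \<subseteq> fv \<phi> \<and> univ_closure (\<phi> \<^bold>\<leftrightarrow> \<psi>) \<in> T)"

definition on_open_cones :: "'j \<Rightarrow> ('c, 'j, 'k) fm set" where
  "on_open_cones j = (let x = Var 0; y = Var 1; x' = Var 2; y' = Var 3 in
    {Alls [0, 1] (Rel j x y \<^bold>\<rightarrow> x \<^bold>\<parallel> y),
     Alls [0, 1, 2, 3]
       (x \<^bold>\<parallel> y \<^bold>\<and> x \<^bold>\<sqinter> y \<^bold>< x \<^bold>\<sqinter> x' \<^bold>\<and> x \<^bold>\<sqinter> y \<^bold>< y \<^bold>\<sqinter> y' \<^bold>\<rightarrow> (Rel j x y \<^bold>\<leftrightarrow> Rel j x' y'))})"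

definition binary_cone_expansion :: "'j set \<Rightarrow> 'k set \<Rightarrow> ('c, 'j, 'k) fm set \<Rightarrow> bool" where
  "binary_cone_expansion J K T \<longleftrightarrow>
     complete_theory J K T \<and> DMT \<subseteq> T \<and> eliminates_quantifiers J K T \<and>
     (\<forall>j\<in>J. on_open_cones j \<subseteq> T)"


section \<open>Types and monster models\<close>

text \<open>
  From here on, parameters are elements of a structure and name themselves (\<open>\<iota> = id\<close>).

  \<open>tp J K N k a A\<close> is the type of the finite tuple \<open>a\<close> over \<open>A\<close> in \<open>N\<close>, in the variables
  with indices \<open>k, \<dots>, k + length a - 1\<close>. The offset \<open>k\<close> makes it possible to write the types of two
  tuples in disjoint tuples of variables.
\<close>

definition tp ::
  "'j set \<Rightarrow> 'k set \<Rightarrow> ('a, 'j, 'k) struct \<Rightarrow> nat \<Rightarrow> 'a list \<Rightarrow> 'a set \<Rightarrow> ('a, 'j, 'k) fm set" where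
  "tp J K N k a A =
     {\<phi> \<in> Fm J K A. fv \<phi> \<subseteq> {k..<k + length a} \<and> sat N id (\<lambda>i. a ! (i - k)) \<phi>}"

definition model_of :: "('a, 'j, 'k) fm set \<Rightarrow> ('a, 'j, 'k) struct \<Rightarrow> bool" where
  "model_of T M \<longleftrightarrow>
     is_struct M \<and> (\<forall>\<sigma>\<in>T. \<forall>s. range s \<subseteq> carrier M \<longrightarrow> sat M id s \<sigma>)"

definition elementary_extension ::
  "'j set \<Rightarrow> 'k set \<Rightarrow> ('a, 'j, 'k) struct \<Rightarrow> ('a, 'j, 'k) struct \<Rightarrow> bool" where
  "elementary_extension J K M N \<longleftrightarrow>
     is_struct M \<and> is_struct N \<and> carrier M \<subseteq> carrier N \<and>
     (\<forall>\<phi>\<in>Fm J K {}. \<forall>s. range s \<subseteq> carrier M \<longrightarrow> (sat M id s \<phi> \<longleftrightarrow> sat N id s \<phi>))"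

definition saturated ::
  "'j set \<Rightarrow> 'k set \<Rightarrow> 'd rel \<Rightarrow> ('a, 'j, 'k) struct \<Rightarrow> bool" where
  "saturated J K \<kappa> M \<longleftrightarrow>
     (\<forall>A n \<Sigma>. A \<subseteq> carrier M \<and> |A| <o \<kappa> \<and>
        \<Sigma> \<subseteq> {\<phi> \<in> Fm J K A. fv \<phi> \<subseteq> {..<n}} \<and>
        (\<forall>\<Phi>\<subseteq>\<Sigma>. finite \<Phi> \<longrightarrow> (\<exists>s. range s \<subseteq> carrier M \<and> (\<forall>\<phi>\<in>\<Phi>. sat M id s \<phi>)))
        \<longrightarrow> (\<exists>s. range s \<subseteq> carrier M \<and> (\<forall>\<phi>\<in>\<Sigma>. sat M id s \<phi>)))"

definition automorphism ::
  "'j set \<Rightarrow> 'k set \<Rightarrow> ('a, 'j, 'k) struct \<Rightarrow> ('a \<Rightarrow> 'a) \<Rightarrow> bool" where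
  "automorphism J K M g \<longleftrightarrow>
     bij_betw g (carrier M) (carrier M) \<and>
     (\<forall>x\<in>carrier M. \<forall>y\<in>carrier M.
        (lt M (g x) (g y) \<longleftrightarrow> lt M x y) \<and>
        mt M (g x) (g y) = g (mt M x y) \<and>
        (\<forall>j\<in>J. rel M j (g x) (g y) \<longleftrightarrow> rel M j x y)) \<and>
     (\<forall>x\<in>carrier M. \<forall>k\<in>K. prd M k (g x) \<longleftrightarrow> prd M k x)"

text \<open>
  A partial elementary map with domain \<open>A\<close> is one such that every L(A)-sentence keeps its truth
  value when each parameter \<open>c\<close> is interpreted as \<open>f c\<close> instead of \<open>c\<close>.
\<close>

definition strongly_homogeneous ::
  "'j set \<Rightarrow> 'k set \<Rightarrow> 'd rel \<Rightarrow> ('a, 'j, 'k) struct \<Rightarrow> bool" where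
  "strongly_homogeneous J K \<kappa> M \<longleftrightarrow>
     (\<forall>A f. A \<subseteq> carrier M \<and> |A| <o \<kappa> \<and> f ` A \<subseteq> carrier M \<and>
        (\<forall>\<sigma>\<in>Sent J K A. \<forall>s. range s \<subseteq> carrier M \<longrightarrow> (sat M id s \<sigma> \<longleftrightarrow> sat M f s \<sigma>))
        \<longrightarrow> (\<exists>g. automorphism J K M g \<and> (\<forall>x\<in>A. g x = f x)))"

text \<open>
  The cardinal \<open>\<kappa>\<close> is large in the minimal sense that it exceeds the number of L-formulas, i.e.
  \<open>\<kappa> > |L| + \<aleph>\<^sub>0\<close>; any stronger reading of "large" only restricts the class of monster models.
\<close>

definition monster_model ::
  "'j set \<Rightarrow> 'k set \<Rightarrow> ('a, 'j, 'k) fm set \<Rightarrow> 'd rel \<Rightarrow> ('a, 'j, 'k) struct \<Rightarrow> bool" where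
  "monster_model J K T \<kappa> M \<longleftrightarrow>
     Card_order \<kappa> \<and> |Fm J K {} :: ('a, 'j, 'k) fm set| <o \<kappa> \<and>
     model_of T M \<and> saturated J K \<kappa> M \<and> strongly_homogeneous J K \<kappa> M"

definition invariant ::
  "'j set \<Rightarrow> 'k set \<Rightarrow> 'd rel \<Rightarrow> ('a, 'j, 'k) struct \<Rightarrow> ('a, 'j, 'k) fm set \<Rightarrow> bool" where
  "invariant J K \<kappa> M p \<longleftrightarrow>
     (\<exists>A. A \<subseteq> carrier M \<and> |A| <o \<kappa> \<and>
        (\<forall>\<phi>\<in>Fm J K {}. \<forall>ys c c'.
           distinct ys \<and> length c = length ys \<and> length c' = length ys \<and>
           set c \<subseteq> carrier M \<and> set c' \<subseteq> carrier M \<and> tp J K M 0 c A = tp J K M 0 c' A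
           \<longrightarrow> (plug ys c \<phi> \<in> p \<longleftrightarrow> plug ys c' \<phi> \<in> p)))"

end

theory Submission
  imports Defs
begin

text \<open>
  By quantifier elimination it suffices to decide atomic formulas. Let the small set \<open>A\<close> consist of
  the points of \<open>U\<close> generated by \<open>a\<close>, \<open>b\<close> and, for each entry \<open>x\<close> of these tuples, some \<open>c \<in> U\<close> with
  \<open>x \<sqinter> c \<notin> U\<close> and the largest point of \<open>U\<close> below \<open>x\<close>, as far as these exist. In a tree each \<open>x\<close> yields at
  most one point \<open>x \<sqinter> c\<close> outside \<open>U\<close>, so every term over \<open>U\<close>, \<open>a\<close>, \<open>b\<close> equals a point of \<open>U\<close> or a term
  over \<open>A\<close>, \<open>a\<close>, \<open>b\<close>. It remains to compare such a term \<open>t\<close> with a point \<open>u \<in> U\<close>. Their order is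
  read off from \<open>t \<sqinter> u\<close>, which is a point of \<open>U\<close> or one of the points \<open>x \<sqinter> c\<close>. If \<open>t\<close> and \<open>u\<close> are
  incomparable, then every generator above \<open>t\<close> lies in the open cone of \<open>t\<close> above \<open>t \<sqinter> u\<close>, so a
  relation on open cones cannot distinguish \<open>t\<close> from that generator, whose type over \<open>U\<close> is given.
\<close>

section \<open>Meet-trees with relations on open cones\<close>

locale cone_tree =
  fixes M :: "('m, 'j, 'k) struct" and J :: "'j set"
  assumes mt_closed: "\<lbrakk>x \<in> carrier M; y \<in> carrier M\<rbrakk> \<Longrightarrow> mt M x y \<in> carrier M"
    and lt_irrefl: "x \<in> carrier M \<Longrightarrow> \<not> lt M x x"
    and lt_trans: "\<lbrakk>x \<in> carrier M; y \<in> carrier M; z \<in> carrier M; lt M x y; lt M y z\<rbrakk> \<Longrightarrow> lt M x z"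
    and lt_linear: "\<lbrakk>x \<in> carrier M; y \<in> carrier M; z \<in> carrier M; lt M x z; lt M y z\<rbrakk>
      \<Longrightarrow> lt M x y \<or> x = y \<or> lt M y x"
    and mt_lower: "\<lbrakk>x \<in> carrier M; y \<in> carrier M\<rbrakk>
      \<Longrightarrow> (lt M (mt M x y) x \<or> mt M x y = x) \<and> (lt M (mt M x y) y \<or> mt M x y = y)"
    and mt_greatest: "\<lbrakk>x \<in> carrier M; y \<in> carrier M; z \<in> carrier M; lt M z x \<or> z = x; lt M z y \<or> z = y\<rbrakk>
      \<Longrightarrow> lt M z (mt M x y) \<or> z = mt M x y"
    and rel_parallel: "\<lbrakk>j \<in> J; x \<in> carrier M; y \<in> carrier M; rel M j x y\<rbrakk>
      \<Longrightarrow> \<not> (lt M x y \<or> x = y) \<and> \<not> (lt M y x \<or> y = x)"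
    and rel_cone: "\<lbrakk>j \<in> J; x \<in> carrier M; y \<in> carrier M; x' \<in> carrier M; y' \<in> carrier M;
      \<not> (lt M x y \<or> x = y); \<not> (lt M y x \<or> y = x);
      lt M (mt M x y) (mt M x x'); lt M (mt M x y) (mt M y y')\<rbrakk>
      \<Longrightarrow> rel M j x y \<longleftrightarrow> rel M j x' y'"
begin

section \<open>Order and meets in a tree\<close>

abbreviation le where "le x y \<equiv> lt M x y \<or> x = y"

lemma le_antisym: "\<lbrakk>x \<in> carrier M; y \<in> carrier M; le x y; le y x\<rbrakk> \<Longrightarrow> x = y"
  using lt_trans lt_irrefl by blast

lemma le_trans:
  "\<lbrakk>x \<in> carrier M; y \<in> carrier M; z \<in> carrier M; le x y; le y z\<rbrakk> \<Longrightarrow> le x z"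
  using lt_trans by blast

lemma le_linear:
  "\<lbrakk>x \<in> carrier M; y \<in> carrier M; z \<in> carrier M; le x z; le y z\<rbrakk> \<Longrightarrow> le x y \<or> le y x"
  using lt_linear by blast

lemma mt_le1: "\<lbrakk>x \<in> carrier M; y \<in> carrier M\<rbrakk> \<Longrightarrow> le (mt M x y) x"
  and mt_le2: "\<lbrakk>x \<in> carrier M; y \<in> carrier M\<rbrakk> \<Longrightarrow> le (mt M x y) y"
  using mt_lower by blast+

lemma le_mt_iff:
  "\<lbrakk>x \<in> carrier M; y \<in> carrier M; z \<in> carrier M\<rbrakk> \<Longrightarrow> le z (mt M x y) \<longleftrightarrow> le z x \<and> le z y"
  using mt_greatest mt_le1 mt_le2 le_trans mt_closed by metis

text \<open>By antisymmetry a point is determined by the points below it, so identities between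
  meets reduce to comparing lower bounds.\<close>

lemma mt_unique:
  assumes "x \<in> carrier M" "y \<in> carrier M" "w \<in> carrier M"
    and "\<And>z. z \<in> carrier M \<Longrightarrow> le z w \<longleftrightarrow> le z x \<and> le z y"
  shows "mt M x y = w"
  using assms le_mt_iff le_antisym mt_closed by metis

lemma mt_commute: "\<lbrakk>x \<in> carrier M; y \<in> carrier M\<rbrakk> \<Longrightarrow> mt M x y = mt M y x"
  by (rule mt_unique) (auto simp: mt_closed le_mt_iff)

lemma mt_absorb: "\<lbrakk>x \<in> carrier M; y \<in> carrier M; le x y\<rbrakk> \<Longrightarrow> mt M x y = x"
  by (rule mt_unique) (use le_trans in blast)+

lemma le_iff_mt: "\<lbrakk>x \<in> carrier M; y \<in> carrier M\<rbrakk> \<Longrightarrow> le x y \<longleftrightarrow> mt M x y = x"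
  using mt_absorb mt_le2 by metis

lemma mt_self: "x \<in> carrier M \<Longrightarrow> mt M x x = x"
  by (rule mt_absorb) auto

text \<open>The left side is the meet of \<open>x \<sqinter> u\<close> and
  \<open>y \<sqinter> u\<close>; both lie below \<open>u\<close>, so they are comparable and the
  smaller one is their meet. The order is recorded so that the choice can be matched between two
  structures.\<close>

lemma mt_chain:
  assumes "x \<in> carrier M" "y \<in> carrier M" "u \<in> carrier M"
  shows "mt M (mt M x y) u = mt M x u \<and> le (mt M x u) (mt M y u) \<or>
    mt M (mt M x y) u = mt M y u \<and> le (mt M y u) (mt M x u)"
proof -
  have eq: "mt M (mt M x y) u = mt M (mt M x u) (mt M y u)"
    using assms by (intro mt_unique) (auto simp: mt_closed le_mt_iff)
  have "le (mt M x u) (mt M y u) \<or> le (mt M y u) (mt M x u)"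
    using assms by (intro le_linear[of _ _ u]) (auto simp: mt_closed mt_le2)
  then show ?thesis
    using eq assms mt_absorb mt_commute mt_closed by metis
qed

text \<open>Both \<open>c \<sqinter> d\<close> and \<open>x \<sqinter> d\<close> lie below
  \<open>d\<close>, hence are comparable. If \<open>c \<sqinter> d\<close> is the smaller, it lies
  below \<open>x\<close> and equals \<open>x \<sqinter> c\<close>, which would then belong to
  \<open>V\<close>. Otherwise \<open>x \<sqinter> d\<close> lies below \<open>c\<close>, hence below
  \<open>x \<sqinter> c\<close>.\<close>

lemma mt_outside_le:
  assumes x: "x \<in> carrier M" and V: "V \<subseteq> carrier M" "\<And>u v. u \<in> V \<Longrightarrow> v \<in> V \<Longrightarrow> mt M u v \<in> V"
    and "c \<in> V" "d \<in> V" and new: "mt M x c \<notin> V" and le: "le (mt M x c) (mt M x d)"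
  shows "mt M x c = mt M x d"
proof -
  have c: "c \<in> carrier M" "d \<in> carrier M" and cd: "mt M c d \<in> V" "mt M c d \<in> carrier M"
    using assms by auto
  note clo = x c mt_closed
  have "le (mt M x c) (mt M c d)"
    using le clo by (simp add: le_mt_iff mt_closed mt_le2)
  consider "le (mt M c d) (mt M x d)" | "le (mt M x d) (mt M c d)"
    using le_linear[of "mt M c d" "mt M x d" d] clo mt_le2 by blast
  then show ?thesis
  proof cases
    case 1
    then have "le (mt M c d) (mt M x c)"
      using clo le_mt_iff cd mt_le1 by metis
    with \<open>le (mt M x c) (mt M c d)\<close> have "mt M x c = mt M c d"
      using le_antisym clo by metis
    with new cd show ?thesis by simp
  next
    case 2
    then have "le (mt M x d) (mt M x c)"
      using clo le_mt_iff mt_le1 by metis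
    then show ?thesis using le le_antisym clo by metis
  qed
qed

text \<open>So \<open>x\<close> generates over a substructure \<open>V\<close> at most one new point of the form \<open>x \<sqinter> c\<close>.\<close>

lemma mt_outside_unique:
  assumes "x \<in> carrier M" "V \<subseteq> carrier M" "\<And>u v. u \<in> V \<Longrightarrow> v \<in> V \<Longrightarrow> mt M u v \<in> V"
    and "c \<in> V" "d \<in> V" "mt M x c \<notin> V" "mt M x d \<notin> V"
  shows "mt M x c = mt M x d"
proof -
  have "le (mt M x c) (mt M x d) \<or> le (mt M x d) (mt M x c)"
    using assms le_linear[of "mt M x c" "mt M x d" x] mt_le1 mt_closed subsetD[OF assms(2)] by blast
  then show ?thesis
    using mt_outside_le[of x V c d] mt_outside_le[of x V d c] assms by metis
qed

text \<open>Since \<open>x \<sqinter> x' = x\<close> lies strictly above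
  \<open>x \<sqinter> y\<close>, the points \<open>x\<close> and \<open>x'\<close> share an open
  cone above \<open>x \<sqinter> y\<close>.\<close>

lemma rel_above_left:
  assumes "j \<in> J" "x \<in> carrier M" "y \<in> carrier M" "x' \<in> carrier M" "le x x'"
    and "\<not> le x y" "\<not> le y x"
  shows "rel M j x y \<longleftrightarrow> rel M j x' y"
proof -
  have "mt M x x' = x" "mt M y y = y" using assms mt_absorb mt_self by blast+
  moreover have "lt M (mt M x y) x" "lt M (mt M x y) y"
    using assms mt_lower le_iff_mt by (metis, metis)
  ultimately show ?thesis using assms by (intro rel_cone) auto
qed

lemma rel_above_right:
  assumes "j \<in> J" "x \<in> carrier M" "y \<in> carrier M" "x' \<in> carrier M" "le x x'"
    and "\<not> le x y" "\<not> le y x"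
  shows "rel M j y x \<longleftrightarrow> rel M j y x'"
proof -
  have "mt M x x' = x" "mt M y y = y" using assms mt_absorb mt_self by blast+
  moreover have "lt M (mt M y x) x" "lt M (mt M y x) y"
    using assms mt_lower le_iff_mt mt_commute by (metis, metis)
  ultimately show ?thesis using assms by (intro rel_cone) auto
qed

end


section \<open>Formulas\<close>

lemma val_closed:
  assumes "is_struct M" "\<iota> ` pars_tm t \<subseteq> carrier M" "s ` fv_tm t \<subseteq> carrier M"
  shows "val M \<iota> s t \<in> carrier M"
  using assms by (induction t) (auto simp: is_struct_def image_Un)

lemma val_cong:
  assumes "\<And>c. c \<in> pars_tm t \<Longrightarrow> \<iota> c = \<iota>' c" "\<And>i. i \<in> fv_tm t \<Longrightarrow> s i = s' i"
  shows "val M \<iota> s t = val M \<iota>' s' t"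
  using assms by (induction t) auto

lemma sat_cong:
  assumes "\<And>c. c \<in> pars \<phi> \<Longrightarrow> \<iota> c = \<iota>' c" "\<And>i. i \<in> fv \<phi> \<Longrightarrow> s i = s' i"
  shows "sat M \<iota> s \<phi> \<longleftrightarrow> sat M \<iota>' s' \<phi>"
  using assms
proof (induction \<phi> arbitrary: s s')
  case (Eq t u)
  then show ?case using val_cong[of t \<iota> \<iota>' s s' M] val_cong[of u \<iota> \<iota>' s s' M] by simp
next
  case (Lt t u)
  then show ?case using val_cong[of t \<iota> \<iota>' s s' M] val_cong[of u \<iota> \<iota>' s s' M] by simp
next
  case (Rel j t u)
  then show ?case using val_cong[of t \<iota> \<iota>' s s' M] val_cong[of u \<iota> \<iota>' s s' M] by simp
next
  case (Prd k t)
  then show ?case using val_cong[of t \<iota> \<iota>' s s' M] by simp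
next
  case (Imp \<phi> \<psi>)
  then show ?case by (metis UnCI fm.set(6) fv.simps(6) sat.simps(6))
next
  case (Forall n \<phi>)
  have "sat M \<iota> (s(n := x)) \<phi> \<longleftrightarrow> sat M \<iota>' (s'(n := x)) \<phi>" for x
    using Forall.prems by (intro Forall.IH) auto
  then show ?case by simp
qed simp

lemma sat_Alls_D:
  assumes "sat M \<iota> s (Alls ns \<phi>)" "range s \<subseteq> carrier M"
  shows "sat M \<iota> s \<phi>"
  using assms
proof (induction ns)
  case (Cons n ns)
  then have "sat M \<iota> (s(n := s n)) (Alls ns \<phi>)" by (auto simp del: fun_upd_triv)
  with Cons show ?case by simp
qed simp

section \<open>Substituting parameters for variables, and conversely\<close>

definition override :: "(nat \<Rightarrow> 'c option) \<Rightarrow> ('c \<Rightarrow> 'm) \<Rightarrow> (nat \<Rightarrow> 'm) \<Rightarrow> nat \<Rightarrow> 'm" where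
  "override \<sigma> \<iota> s i = (case \<sigma> i of None \<Rightarrow> s i | Some c \<Rightarrow> \<iota> c)"

lemma val_inst_tm: "val M \<iota> s (inst_tm \<sigma> t) = val M \<iota> (override \<sigma> \<iota> s) t"
  by (induction t) (auto simp: override_def split: option.split)

lemma sat_inst: "sat M \<iota> s (inst \<sigma> \<phi>) \<longleftrightarrow> sat M \<iota> (override \<sigma> \<iota> s) \<phi>"
proof (induction \<phi> arbitrary: \<sigma> s)
  case (Forall n \<phi>)
  have "override (\<sigma>(n := None)) \<iota> (s(n := x)) = (override \<sigma> \<iota> s)(n := x)" for x
    by (auto simp: override_def fun_eq_iff split: option.split)
  with Forall show ?case by (simp del: fun_upd_apply)
qed (auto simp: val_inst_tm)

lemma fv_tm_inst_tm: "fv_tm (inst_tm \<sigma> t) = fv_tm t - dom \<sigma>"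
  by (induction t) (auto split: option.split)

lemma pars_tm_inst_tm: "pars_tm (inst_tm \<sigma> t) \<subseteq> pars_tm t \<union> ran \<sigma>"
  by (induction t) (auto split: option.split simp: ran_def)

lemma qfree_inst:
  assumes "qfree \<phi>"
  shows "qfree (inst \<sigma> \<phi>)" "fv (inst \<sigma> \<phi>) = fv \<phi> - dom \<sigma>"
    "pars (inst \<sigma> \<phi>) \<subseteq> pars \<phi> \<union> ran \<sigma>" "rels (inst \<sigma> \<phi>) = rels \<phi>" "prds (inst \<sigma> \<phi>) = prds \<phi>"
  using assms by (induction \<phi>)
    (auto simp: fv_tm_inst_tm dest: subsetD[OF pars_tm_inst_tm])

fun abstract_tm :: "('c \<Rightarrow> nat) \<Rightarrow> 'c tm \<Rightarrow> 'c tm" where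
  "abstract_tm f (Var n) = Var n"
| "abstract_tm f (Par c) = Var (f c)"
| "abstract_tm f (s \<^bold>\<sqinter> t) = abstract_tm f s \<^bold>\<sqinter> abstract_tm f t"

text \<open>Undoes the substitution of parameters, with the variable \<open>f c\<close> standing for
  \<open>c\<close>. No bound variable is renamed, so \<open>f\<close> has to be chosen
  fresh.\<close>

fun abstract :: "('c \<Rightarrow> nat) \<Rightarrow> ('c, 'j, 'k) fm \<Rightarrow> ('c, 'j, 'k) fm" where
  "abstract f Fls = Fls"
| "abstract f (s \<^bold>= t) = (abstract_tm f s \<^bold>= abstract_tm f t)"
| "abstract f (s \<^bold>< t) = (abstract_tm f s \<^bold>< abstract_tm f t)"
| "abstract f (Rel j s t) = Rel j (abstract_tm f s) (abstract_tm f t)"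
| "abstract f (Prd k t) = Prd k (abstract_tm f t)"
| "abstract f (\<phi> \<^bold>\<rightarrow> \<psi>) = abstract f \<phi> \<^bold>\<rightarrow> abstract f \<psi>"
| "abstract f (Forall n \<phi>) = Forall n (abstract f \<phi>)"

text \<open>Bound variables are counted too, so that a variable outside \<open>vars\<close> cannot
  be captured.\<close>

fun vars :: "('c, 'j, 'k) fm \<Rightarrow> nat set" where
  "vars (\<phi> \<^bold>\<rightarrow> \<psi>) = vars \<phi> \<union> vars \<psi>"
| "vars (Forall n \<phi>) = insert n (vars \<phi>)"
| "vars \<phi> = fv \<phi>"

lemma finite_fv_tm: "finite (fv_tm t)"
  by (induction t) auto

lemma finite_vars: "finite (vars \<phi>)"
  by (induction \<phi>) (auto simp: finite_fv_tm)

lemma finite_pars_tm: "finite (pars_tm t)"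
  by (induction t) auto

lemma finite_pars: "finite (pars \<phi>)"
  by (induction \<phi>) (auto simp: finite_pars_tm)

lemma abstract_tm_props:
  "pars_tm (abstract_tm f t) = {}" "fv_tm (abstract_tm f t) = fv_tm t \<union> f ` pars_tm t"
  by (induction t) auto

lemma abstract_props:
  "pars (abstract f \<phi>) = {}" "rels (abstract f \<phi>) = rels \<phi>" "prds (abstract f \<phi>) = prds \<phi>"
  "fv (abstract f \<phi>) \<subseteq> fv \<phi> \<union> f ` pars \<phi>"
  by (induction \<phi>) (auto simp: abstract_tm_props)

lemma inst_tm_abstract_tm:
  assumes "\<And>i. i \<in> fv_tm t \<Longrightarrow> \<sigma> i = None" "\<And>c. c \<in> pars_tm t \<Longrightarrow> \<sigma> (f c) = Some c"
  shows "inst_tm \<sigma> (abstract_tm f t) = t"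
  using assms by (induction t) auto

lemma inst_abstract:
  assumes "\<And>i. i \<in> vars \<phi> \<Longrightarrow> \<sigma> i = None" "\<And>c. c \<in> pars \<phi> \<Longrightarrow> \<sigma> (f c) = Some c"
  shows "inst \<sigma> (abstract f \<phi>) = \<phi>"
  using assms
proof (induction \<phi> arbitrary: \<sigma>)
  case (Forall n \<phi>)
  have "\<sigma>(n := None) = \<sigma>" using Forall.prems by auto
  with Forall show ?case by auto
qed (auto simp: inst_tm_abstract_tm)

text \<open>Quantifier elimination is assumed for formulas without parameters only.\<close>

lemma qe_parameters:
  fixes T :: "('a, 'j, 'k) fm set"
  assumes qe: "eliminates_quantifiers J K T" and \<phi>: "\<phi> \<in> Fm J K V"
  obtains \<rho> \<phi>\<^sub>0 \<psi>\<^sub>0 where "\<phi> = inst \<rho> \<phi>\<^sub>0" "inst \<rho> \<psi>\<^sub>0 \<in> Fm J K V" "qfree (inst \<rho> \<psi>\<^sub>0)"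
    "fv (inst \<rho> \<psi>\<^sub>0) \<subseteq> fv \<phi>" "ran \<rho> \<subseteq> V" "univ_closure (\<phi>\<^sub>0 \<^bold>\<leftrightarrow> \<psi>\<^sub>0) \<in> T"
proof -
  obtain h :: "'a \<Rightarrow> nat" where h: "inj_on h (pars \<phi>)"
    using finite_pars finite_imp_inj_to_nat_seg by metis
  \<comment> \<open>The shift moves \<open>h\<close> beyond all variables of \<open>\<phi>\<close>;
    the inserted 0 keeps the maximum defined when there are none.\<close>
  define f where "f = (\<lambda>c. h c + Suc (Max (insert 0 (vars \<phi>))))"
  have f: "inj_on f (pars \<phi>)" using h by (auto simp: f_def inj_on_def)
  have new: "f c \<notin> vars \<phi>" for c
  proof
    assume "f c \<in> vars \<phi>"
    then have "f c \<le> Max (insert 0 (vars \<phi>))" using finite_vars[of \<phi>] by simp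
    then show False by (simp add: f_def)
  qed
  define \<rho> where "\<rho> i = (if i \<in> f ` pars \<phi> then Some (inv_into (pars \<phi>) f i) else None)" for i
  have \<rho>: "\<rho> (f c) = Some c" if "c \<in> pars \<phi>" for c
    using that f by (simp add: \<rho>_def)
  have ran: "ran \<rho> \<subseteq> pars \<phi>" and dom: "dom \<rho> = f ` pars \<phi>"
    by (auto simp: \<rho>_def ran_def dom_def inv_into_into split: if_splits)
  have "pars \<phi> \<subseteq> V" using \<phi> by (simp add: Fm_def)
  have eq: "inst \<rho> (abstract f \<phi>) = \<phi>"
  proof (rule inst_abstract)
    show "\<rho> i = None" if "i \<in> vars \<phi>" for i using that new by (auto simp: \<rho>_def)
  qed (rule \<rho>)
  have "abstract f \<phi> \<in> Fm J K {}" using \<phi> by (simp add: Fm_def abstract_props)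
  then obtain \<psi>\<^sub>0 where \<psi>\<^sub>0: "\<psi>\<^sub>0 \<in> Fm J K {}" "qfree \<psi>\<^sub>0" "fv \<psi>\<^sub>0 \<subseteq> fv (abstract f \<phi>)"
    "univ_closure (abstract f \<phi> \<^bold>\<leftrightarrow> \<psi>\<^sub>0) \<in> T"
    using qe unfolding eliminates_quantifiers_def by blast
  show thesis
  proof (rule that)
    show "\<phi> = inst \<rho> (abstract f \<phi>)" using eq by simp
    show "inst \<rho> \<psi>\<^sub>0 \<in> Fm J K V"
      using qfree_inst[OF \<psi>\<^sub>0(2), of \<rho>] \<psi>\<^sub>0(1) ran \<open>pars \<phi> \<subseteq> V\<close> by (auto simp: Fm_def)
    show "fv (inst \<rho> \<psi>\<^sub>0) \<subseteq> fv \<phi>"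
      using qfree_inst(2)[OF \<psi>\<^sub>0(2), of \<rho>] \<psi>\<^sub>0(3) abstract_props(4)[of f \<phi>] dom by auto
  qed (use \<psi>\<^sub>0 qfree_inst ran \<open>pars \<phi> \<subseteq> V\<close> in auto)
qed

text \<open>The closed equivalence holds in particular under the assignment
  \<open>override \<rho> \<iota> s\<close>, which gives the substituted variables their parameters
  as values.\<close>

lemma sat_inst_iff:
  assumes "\<And>s. range s \<subseteq> carrier M \<Longrightarrow> sat M \<iota> s (univ_closure (\<phi> \<^bold>\<leftrightarrow> \<psi>))"
    and "range s \<subseteq> carrier M" "\<iota> ` ran \<rho> \<subseteq> carrier M"
  shows "sat M \<iota> s (inst \<rho> \<phi>) \<longleftrightarrow> sat M \<iota> s (inst \<rho> \<psi>)"
proof -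
  have "override \<rho> \<iota> s i \<in> carrier M" for i
    using assms(2,3) by (cases "\<rho> i") (auto simp: override_def image_subset_iff intro: ranI)
  then have "range (override \<rho> \<iota> s) \<subseteq> carrier M" by blast
  then have "sat M \<iota> (override \<rho> \<iota> s) (\<phi> \<^bold>\<leftrightarrow> \<psi>)"
    using assms(1) sat_Alls_D unfolding univ_closure_def by blast
  then show ?thesis by (auto simp: sat_inst)
qed

lemma cone_tree_of_DMT:
  assumes M: "is_struct M" and T: "\<And>\<sigma> s. \<lbrakk>\<sigma> \<in> T; range s \<subseteq> carrier M\<rbrakk> \<Longrightarrow> sat M \<iota> s \<sigma>"
    and sub: "DMT \<subseteq> T" "\<And>j. j \<in> J \<Longrightarrow> on_open_cones j \<subseteq> T"
  shows "cone_tree M J"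
proof -
  obtain e where e: "e \<in> carrier M" using M by (auto simp: is_struct_def)
  \<comment> \<open>The axioms are sentences, so a constant assignment suffices to evaluate
    them.\<close>
  then have r: "range (\<lambda>_::nat. e) \<subseteq> carrier M" by auto
  have ax: "sat M \<iota> (\<lambda>_. e) \<sigma>" if "\<sigma> \<in> DMT" for \<sigma> using that T sub r by blast
  have cone: "sat M \<iota> (\<lambda>_. e) \<sigma>" if "\<sigma> \<in> on_open_cones j" "j \<in> J" for \<sigma> j
    using that T sub r by blast
  have DMT: "Forall 0 (Neg (Var 0 \<^bold>< Var 0)) \<in> DMT"
    "Alls [0, 1, 2] (Var 0 \<^bold>< Var 1 \<^bold>\<and> Var 1 \<^bold>< Var 2 \<^bold>\<rightarrow> Var 0 \<^bold>< Var 2) \<in> DMT"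
    "Alls [0, 1, 2] (Var 0 \<^bold>< Var 2 \<^bold>\<and> Var 1 \<^bold>< Var 2
      \<^bold>\<rightarrow> Var 0 \<^bold>< Var 1 \<^bold>\<or> Var 0 \<^bold>= Var 1 \<^bold>\<or> Var 1 \<^bold>< Var 0) \<in> DMT"
    "Alls [0, 1] (Var 0 \<^bold>\<sqinter> Var 1 \<^bold>\<le> Var 0 \<^bold>\<and> Var 0 \<^bold>\<sqinter> Var 1 \<^bold>\<le> Var 1) \<in> DMT"
    "Alls [0, 1, 2] (Var 2 \<^bold>\<le> Var 0 \<^bold>\<and> Var 2 \<^bold>\<le> Var 1 \<^bold>\<rightarrow> Var 2 \<^bold>\<le> Var 0 \<^bold>\<sqinter> Var 1) \<in> DMT"
    unfolding DMT_def Let_def by (blast intro: UnI1 insertI1 insertI2)+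
  have irrefl: "\<forall>x\<in>carrier M. \<not> lt M x x"
    using ax[OF DMT(1), simplified] by blast
  have trans: "\<forall>x\<in>carrier M. \<forall>y\<in>carrier M. \<forall>z\<in>carrier M. lt M x y \<and> lt M y z \<longrightarrow> lt M x z"
    using ax[OF DMT(2), simplified] by blast
  have linear: "\<forall>x\<in>carrier M. \<forall>y\<in>carrier M. \<forall>z\<in>carrier M.
      lt M x z \<and> lt M y z \<longrightarrow> (\<not> lt M x y \<longrightarrow> x \<noteq> y \<longrightarrow> lt M y x)"
    using ax[OF DMT(3), simplified] by blast
  have lower: "\<forall>x\<in>carrier M. \<forall>y\<in>carrier M.
      (\<not> lt M (mt M x y) x \<longrightarrow> mt M x y = x) \<and> (\<not> lt M (mt M x y) y \<longrightarrow> mt M x y = y)"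
    using ax[OF DMT(4), simplified] by blast
  have greatest: "\<forall>x\<in>carrier M. \<forall>y\<in>carrier M. \<forall>z\<in>carrier M.
      (\<not> lt M z x \<longrightarrow> z = x) \<and> (\<not> lt M z y \<longrightarrow> z = y) \<longrightarrow> (\<not> lt M z (mt M x y) \<longrightarrow> z = mt M x y)"
    using ax[OF DMT(5), simplified] by blast
  have cone_ax: "Alls [0, 1] (Rel j (Var 0) (Var 1) \<^bold>\<rightarrow> Var 0 \<^bold>\<parallel> Var 1) \<in> on_open_cones j"
    "Alls [0, 1, 2, 3] (Var 0 \<^bold>\<parallel> Var 1
      \<^bold>\<and> Var 0 \<^bold>\<sqinter> Var 1 \<^bold>< Var 0 \<^bold>\<sqinter> Var 2 \<^bold>\<and> Var 0 \<^bold>\<sqinter> Var 1 \<^bold>< Var 1 \<^bold>\<sqinter> Var 3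
      \<^bold>\<rightarrow> (Rel j (Var 0) (Var 1) \<^bold>\<leftrightarrow> Rel j (Var 2) (Var 3))) \<in> on_open_cones j" for j
    unfolding on_open_cones_def Let_def by blast+
  have parallel: "\<forall>x\<in>carrier M. \<forall>y\<in>carrier M. rel M j x y \<longrightarrow>
      \<not> lt M x y \<and> x \<noteq> y \<and> \<not> lt M y x" if "j \<in> J" for j
    using cone[OF cone_ax(1) that, simplified] by blast
  have cones: "\<forall>x\<in>carrier M. \<forall>y\<in>carrier M. \<forall>x'\<in>carrier M. \<forall>y'\<in>carrier M.
      \<not> (lt M x y \<or> x = y) \<and> \<not> (lt M y x \<or> y = x) \<and>
      lt M (mt M x y) (mt M x x') \<and> lt M (mt M x y) (mt M y y') \<longrightarrow>
      (rel M j x y \<longleftrightarrow> rel M j x' y')" if "j \<in> J" for j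
    using cone[OF cone_ax(2) that, simplified] by blast
  show ?thesis
  proof (unfold_locales, goal_cases)
    case 1
    then show ?case using M unfolding is_struct_def by blast
  next
    case 2
    then show ?case using irrefl by blast
  next
    case 3
    then show ?case using trans by blast
  next
    case 4
    then show ?case using linear by blast
  next
    case 5
    then show ?case using lower by blast
  next
    case 6
    then show ?case using greatest by blast
  next
    case (7 j)
    then show ?case using parallel[of j] by metis
  next
    case (8 j x y x' y')
    then show ?case using cones[of j] by blast
  qed
qed


section \<open>Two realisations agreeing over small sets\<close>

text \<open>\<open>M\<close> is the extension containing the substructure \<open>V\<close>, with
  \<open>s\<close> naming the tuple; \<open>M'\<close> is an arbitrary structure with its own
  interpretation \<open>\<iota>\<close> of the parameters. \<open>agree_single\<close> and
  \<open>agree_small\<close> express the given types. The last three assumptions say what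
  \<open>A\<close> contains: the generated points of \<open>V\<close>, a witness for the new point
  below each \<open>s i\<close>, and the largest point of \<open>V\<close> below \<open>s i\<close>,
  if they exist.\<close>

locale agreement = L: cone_tree M J + R: cone_tree M' J
  for M :: "('a, 'j, 'k) struct" and M' :: "('m, 'j, 'k) struct" and J :: "'j set" +
  fixes K :: "'k set" and \<iota> :: "'a \<Rightarrow> 'm" and s :: "nat \<Rightarrow> 'a" and s' :: "nat \<Rightarrow> 'm"
    and n :: nat and V A :: "'a set"
  assumes struct: "is_struct M" "is_struct M'"
    and range_s: "range s \<subseteq> carrier M" and range_s': "range s' \<subseteq> carrier M'"
    and V: "V \<subseteq> carrier M" and range_\<iota>: "range \<iota> \<subseteq> carrier M'"
    and V_mt: "\<lbrakk>u \<in> V; v \<in> V\<rbrakk> \<Longrightarrow> mt M u v \<in> V"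
    and A: "A \<subseteq> V"
    and agree_single: "\<lbrakk>\<phi> \<in> Fm J K V; fv \<phi> \<subseteq> {i} \<inter> {..<n}\<rbrakk> \<Longrightarrow> sat M id s \<phi> \<longleftrightarrow> sat M' \<iota> s' \<phi>"
    and agree_small: "\<lbrakk>\<phi> \<in> Fm J K A; fv \<phi> \<subseteq> {..<n}\<rbrakk> \<Longrightarrow> sat M id s \<phi> \<longleftrightarrow> sat M' \<iota> s' \<phi>"
    and A_closed: "\<lbrakk>pars_tm t \<subseteq> A; fv_tm t \<subseteq> {..<n}; val M id s t \<in> V\<rbrakk> \<Longrightarrow> val M id s t \<in> A"
    and A_new: "\<lbrakk>i < n; u \<in> V; mt M (s i) u \<notin> V\<rbrakk> \<Longrightarrow> \<exists>c\<in>A. mt M (s i) c \<notin> V"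
    and A_max: "\<lbrakk>i < n; w \<in> V; L.le w (s i); \<And>u. \<lbrakk>u \<in> V; L.le u (s i)\<rbrakk> \<Longrightarrow> \<not> lt M w u\<rbrakk> \<Longrightarrow> w \<in> A"
begin

section \<open>Terms and truth values on the two sides\<close>

definition vL where "vL t = val M id s t"
definition vR where "vR t = val M' \<iota> s' t"

lemma vL_simps [simp]: "vL (Var i) = s i" "vL (Par c) = c" "vL (t \<^bold>\<sqinter> u) = mt M (vL t) (vL u)"
  and vR_simps [simp]: "vR (Var i) = s' i" "vR (Par c) = \<iota> c" "vR (t \<^bold>\<sqinter> u) = mt M' (vR t) (vR u)"
  by (simp_all add: vL_def vR_def)

definition tms :: "'a set \<Rightarrow> 'a tm set" where
  "tms B = {t. pars_tm t \<subseteq> B \<and> fv_tm t \<subseteq> {..<n}}"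

definition agree :: "('a, 'j, 'k) fm \<Rightarrow> bool" where
  "agree \<phi> \<longleftrightarrow> (sat M id s \<phi> \<longleftrightarrow> sat M' \<iota> s' \<phi>)"

lemma agree_simps:
  "agree (t \<^bold>= u) \<longleftrightarrow> (vL t = vL u \<longleftrightarrow> vR t = vR u)"
  "agree (t \<^bold>< u) \<longleftrightarrow> (lt M (vL t) (vL u) \<longleftrightarrow> lt M' (vR t) (vR u))"
  "agree (Rel j t u) \<longleftrightarrow> (rel M j (vL t) (vL u) \<longleftrightarrow> rel M' j (vR t) (vR u))"
  "agree (Prd k t) \<longleftrightarrow> (prd M k (vL t) \<longleftrightarrow> prd M' k (vR t))"
  by (auto simp: agree_def vL_def vR_def)

lemma agree_le: "agree (t \<^bold>\<le> u) \<longleftrightarrow> (L.le (vL t) (vL u) \<longleftrightarrow> R.le (vR t) (vR u))"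
  by (auto simp: agree_def vL_def vR_def)

text \<open>Terms equal on both sides at once may replace each other in atomic claims of
  agreement.\<close>

definition same :: "'a tm \<Rightarrow> 'a tm \<Rightarrow> bool" where
  "same t u \<longleftrightarrow> vL t = vL u \<and> vR t = vR u"

definition basic :: "'a tm set" where
  "basic = Par ` V \<union> {Var i \<^bold>\<sqinter> Par c | i c. i < n \<and> c \<in> A}"

lemma basic_cases:
  assumes "t \<in> basic"
  obtains (par) u where "u \<in> V" "t = Par u" | (new) i c where "i < n" "c \<in> A" "t = Var i \<^bold>\<sqinter> Par c"
  using assms by (auto simp: basic_def)

lemma agree_singleI: "\<phi> \<in> Fm J K V \<Longrightarrow> fv \<phi> \<subseteq> {i} \<Longrightarrow> fv \<phi> \<subseteq> {..<n} \<Longrightarrow> agree \<phi>"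
  using agree_single[of \<phi> i] by (auto simp: agree_def)

lemma agree_smallI: "\<phi> \<in> Fm J K A \<Longrightarrow> fv \<phi> \<subseteq> {..<n} \<Longrightarrow> agree \<phi>"
  using agree_small by (auto simp: agree_def)

lemma basic_tms: "t \<in> basic \<Longrightarrow> t \<in> tms V"
  using A by (auto simp: basic_def tms_def)

lemma basic_cases2: "t \<in> basic \<Longrightarrow> t \<in> tms A \<or> (\<exists>u\<in>V. t = Par u)"
  by (auto simp: basic_def tms_def)

lemma vL_closed: "t \<in> tms V \<Longrightarrow> vL t \<in> carrier M"
  unfolding vL_def using V range_s struct by (intro val_closed) (auto simp: tms_def)

lemma vR_closed: "t \<in> tms V \<Longrightarrow> vR t \<in> carrier M'"
  unfolding vR_def using range_\<iota> range_s' struct by (intro val_closed) (auto simp: tms_def)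

lemma tms_A: "t \<in> tms A \<Longrightarrow> t \<in> tms V"
  using A by (auto simp: tms_def)

text \<open>Either the two terms contain at most one variable between them, which
  \<open>agree_single\<close> settles, or each contains one and all parameters are in
  \<open>A\<close>, which \<open>agree_small\<close> settles.\<close>

lemma basic_agree:
  assumes "t \<in> basic" "u \<in> basic"
  shows "agree (t \<^bold>= u)" "agree (t \<^bold>< u)"
proof -
  have "\<exists>i. fv_tm t \<union> fv_tm u \<subseteq> {i} \<inter> {..<n} \<or> t \<in> tms A \<and> u \<in> tms A"
    using assms by (elim basic_cases) (auto simp: tms_def)
  then obtain i where i: "fv_tm t \<union> fv_tm u \<subseteq> {i} \<inter> {..<n} \<or> t \<in> tms A \<and> u \<in> tms A" by blast
  have "pars_tm t \<union> pars_tm u \<subseteq> V" using assms basic_tms by (auto simp: tms_def)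
  then have "agree \<phi>" if "\<phi> \<in> {t \<^bold>= u, t \<^bold>< u}" for \<phi>
    using i
  proof (elim disjE)
    assume "fv_tm t \<union> fv_tm u \<subseteq> {i} \<inter> {..<n}" "pars_tm t \<union> pars_tm u \<subseteq> V"
    then show ?thesis using that by (intro agree_singleI[of _ i]) (auto simp: Fm_def)
  next
    assume "t \<in> tms A \<and> u \<in> tms A"
    then show ?thesis using that by (intro agree_smallI) (auto simp: Fm_def tms_def)
  qed
  then show "agree (t \<^bold>= u)" "agree (t \<^bold>< u)" by auto
qed

section \<open>Equal terms and normal forms\<close>

lemma agree_same_eq: "same t t' \<Longrightarrow> same u u' \<Longrightarrow> agree (t \<^bold>= u) \<longleftrightarrow> agree (t' \<^bold>= u')"
  and agree_same_lt: "same t t' \<Longrightarrow> same u u' \<Longrightarrow> agree (t \<^bold>< u) \<longleftrightarrow> agree (t' \<^bold>< u')"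
  and agree_same_rel: "same t t' \<Longrightarrow> same u u' \<Longrightarrow> agree (Rel j t u) \<longleftrightarrow> agree (Rel j t' u')"
  and agree_same_prd: "same t t' \<Longrightarrow> agree (Prd k t) \<longleftrightarrow> agree (Prd k t')"
  by (auto simp: agree_simps same_def)

lemma same_Par_mt: "u \<in> V \<Longrightarrow> v \<in> V \<Longrightarrow> same (Par u \<^bold>\<sqinter> Par v) (Par (mt M u v))"
  using agree_singleI[of "Par u \<^bold>\<sqinter> Par v \<^bold>= Par (mt M u v)" 0] V_mt
  by (auto simp: same_def Fm_def agree_simps)

lemma same_mtI: "same t t' \<Longrightarrow> same u u' \<Longrightarrow> same (t \<^bold>\<sqinter> u) (t' \<^bold>\<sqinter> u')"
  by (auto simp: same_def)

lemma same_trans: "same t u \<Longrightarrow> same u v \<Longrightarrow> same t v"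
  by (auto simp: same_def)

text \<open>For a variable the meet is a point of \<open>V\<close> or the unique new point, which
  some element of \<open>A\<close> produces. For a meet, \<open>mt_chain\<close> leaves the smaller
  of two basic terms.\<close>

lemma small_meet_Par_basic:
  assumes "t \<in> tms A" "u \<in> V"
  shows "\<exists>t'\<in>basic. same (t \<^bold>\<sqinter> Par u) t'"
  using assms(1)
proof (induction t)
  case (Var i)
  then have i: "i < n" by (simp add: tms_def)
  show ?case
  proof (cases "mt M (s i) u \<in> V")
    case True
    have "agree (Var i \<^bold>\<sqinter> Par u \<^bold>= Par (mt M (s i) u))"
      using i True assms(2) by (intro agree_singleI[of _ i]) (auto simp: Fm_def)
    then have "same (Var i \<^bold>\<sqinter> Par u) (Par (mt M (s i) u))" by (simp add: same_def agree_simps)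
    with True show ?thesis by (auto simp: basic_def)
  next
    case False
    then obtain c where c: "c \<in> A" "mt M (s i) c \<notin> V" using A_new i assms(2) by blast
    then have "mt M (s i) u = mt M (s i) c"
      using False A assms(2) range_s V V_mt by (intro L.mt_outside_unique[of _ V]) auto
    \<comment> \<open>This equation has a single variable and parameters in \<open>V\<close>, so it
      transfers to the other side.\<close>
    moreover have "agree (Var i \<^bold>\<sqinter> Par u \<^bold>= Var i \<^bold>\<sqinter> Par c)"
      using i c A assms(2) by (intro agree_singleI[of _ i]) (auto simp: Fm_def)
    ultimately have "same (Var i \<^bold>\<sqinter> Par u) (Var i \<^bold>\<sqinter> Par c)" by (simp add: same_def agree_simps)
    with i c show ?thesis by (auto simp: basic_def)
  qed
next
  case (Par c)
  then have "c \<in> V" using A by (auto simp: tms_def)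
  then show ?case using same_Par_mt[OF _ assms(2)] V_mt[OF _ assms(2)] unfolding basic_def by blast
next
  case (Mt t1 t2)
  then have t: "t1 \<in> tms A" "t2 \<in> tms A" by (auto simp: tms_def)
  then obtain b1 b2 where b: "b1 \<in> basic" "same (t1 \<^bold>\<sqinter> Par u) b1" "b2 \<in> basic" "same (t2 \<^bold>\<sqinter> Par u) b2"
    using Mt.IH by blast
  have u: "Par u \<in> tms V" using assms(2) by (simp add: tms_def)
  note cl = t[THEN tms_A] u
  have L: "vL (t1 \<^bold>\<sqinter> t2 \<^bold>\<sqinter> Par u) = vL b1 \<and> L.le (vL b1) (vL b2)
      \<or> vL (t1 \<^bold>\<sqinter> t2 \<^bold>\<sqinter> Par u) = vL b2 \<and> L.le (vL b2) (vL b1)"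
    using L.mt_chain[OF cl[THEN vL_closed]] b by (simp add: same_def)
  have R: "vR (t1 \<^bold>\<sqinter> t2 \<^bold>\<sqinter> Par u) = vR b1 \<and> R.le (vR b1) (vR b2)
      \<or> vR (t1 \<^bold>\<sqinter> t2 \<^bold>\<sqinter> Par u) = vR b2 \<and> R.le (vR b2) (vR b1)"
    using R.mt_chain[OF cl[THEN vR_closed]] b by (simp add: same_def)
  \<comment> \<open>The two sides agree on how \<open>b1\<close> and \<open>b2\<close> compare, so
    the same term is the smaller one on both.\<close>
  have ag: "agree (b1 \<^bold>= b2)" "agree (b1 \<^bold>< b2)" "agree (b2 \<^bold>< b1)"
    using basic_agree b by auto
  have c: "vL b1 \<in> carrier M" "vL b2 \<in> carrier M" "vR b1 \<in> carrier M'" "vR b2 \<in> carrier M'"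
    using b basic_tms vL_closed vR_closed by auto
  have "same (t1 \<^bold>\<sqinter> t2 \<^bold>\<sqinter> Par u) b1 \<or> same (t1 \<^bold>\<sqinter> t2 \<^bold>\<sqinter> Par u) b2"
    using L R ag L.le_antisym[OF c(1,2)] R.le_antisym[OF c(3,4)]
    unfolding same_def agree_simps by metis
  with b show ?case by blast
qed

lemma normal_form:
  assumes "t \<in> tms V"
  shows "\<exists>t'. same t t' \<and> (t' \<in> tms A \<or> (\<exists>u\<in>V. t' = Par u))"
  using assms
proof (induction t)
  case (Var i)
  then show ?case by (intro exI[of _ "Var i"]) (auto simp: tms_def same_def)
next
  case (Par c)
  then show ?case by (intro exI[of _ "Par c"]) (auto simp: tms_def same_def)
next
  case (Mt t1 t2)
  then have t: "t1 \<in> tms V" "t2 \<in> tms V" by (auto simp: tms_def)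
  then obtain t1' t2' where s: "same t1 t1'" "same t2 t2'"
    and n: "t1' \<in> tms A \<or> (\<exists>u\<in>V. t1' = Par u)" "t2' \<in> tms A \<or> (\<exists>u\<in>V. t2' = Par u)"
    using Mt.IH by blast
  have "\<exists>t'. same (t1' \<^bold>\<sqinter> t2') t' \<and> (t' \<in> tms A \<or> (\<exists>u\<in>V. t' = Par u))"
  proof -
    consider "t1' \<in> tms A" "t2' \<in> tms A" | u where "u \<in> V" "t1' = Par u" "t2' \<in> tms A"
      | u where "u \<in> V" "t2' = Par u" "t1' \<in> tms A"
      | u v where "u \<in> V" "t1' = Par u" "v \<in> V" "t2' = Par v"
      using n by blast
    then show ?thesis
    proof cases
      case 1
      then show ?thesis by (intro exI[of _ "t1' \<^bold>\<sqinter> t2'"]) (auto simp: same_def tms_def)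
    next
      case (2 u)
      have u: "Par u \<in> tms V" using 2 by (simp add: tms_def)
      have "same (t1' \<^bold>\<sqinter> t2') (t2' \<^bold>\<sqinter> Par u)"
        using 2 L.mt_commute[OF vL_closed vL_closed, OF u tms_A]
          R.mt_commute[OF vR_closed vR_closed, OF u tms_A] by (simp add: same_def)
      then show ?thesis using small_meet_Par_basic[OF 2(3,1)] basic_cases2 same_trans by metis
    next
      case (3 u)
      then show ?thesis using small_meet_Par_basic[OF 3(3,1)] basic_cases2 by metis
    next
      case 4
      then show ?thesis using same_Par_mt V_mt by blast
    qed
  qed
  then show ?case using same_mtI[OF s] same_trans by metis
qed

section \<open>Comparing terms with points of \<open>V\<close>\<close>

lemma generator_above:
  "t \<in> tms B \<Longrightarrow> B \<subseteq> V \<Longrightarrow>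
    \<exists>g. L.le (vL t) (vL g) \<and> R.le (vR t) (vR g) \<and> (g \<in> Var ` {..<n} \<or> g \<in> Par ` B)"
proof (induction t)
  case (Mt t1 t2)
  then have t: "t1 \<in> tms B" "t2 \<in> tms B" "t1 \<in> tms V" "t2 \<in> tms V" by (auto simp: tms_def)
  \<comment> \<open>A meet lies below its left factor, so the leftmost generator works in both
    structures at once.\<close>
  then obtain g where g: "L.le (vL t1) (vL g)" "R.le (vR t1) (vR g)" "g \<in> Var ` {..<n} \<or> g \<in> Par ` B"
    using Mt by blast
  have gV: "g \<in> tms V" using g Mt.prems by (auto simp: tms_def)
  have "L.le (vL (t1 \<^bold>\<sqinter> t2)) (vL t1)" "R.le (vR (t1 \<^bold>\<sqinter> t2)) (vR t1)"
    using t L.mt_le1[OF vL_closed vL_closed] R.mt_le1[OF vR_closed vR_closed] by auto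
  then have "L.le (vL (t1 \<^bold>\<sqinter> t2)) (vL g)" "R.le (vR (t1 \<^bold>\<sqinter> t2)) (vR g)"
    using L.le_trans[of "vL (t1 \<^bold>\<sqinter> t2)" "vL t1" "vL g"] R.le_trans[of "vR (t1 \<^bold>\<sqinter> t2)" "vR t1" "vR g"]
      g t gV vL_closed vR_closed L.mt_closed R.mt_closed by (metis vL_simps(3) vR_simps(3))+
  then show ?case using g by blast
next
  case (Var i)
  then show ?case by (intro exI[of _ "Var i"]) (auto simp: tms_def)
next
  case (Par c)
  then show ?case by (intro exI[of _ "Par c"]) (auto simp: tms_def)
qed

text \<open>A point lies below a meet exactly when it lies below both factors, which reduces the
  claim to generators and hence to formulas with at most one variable. The reverse comparison does
  not split in this way.\<close>

lemma agree_Par_le: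
  assumes "t \<in> tms A" "u \<in> V"
  shows "L.le u (vL t) \<longleftrightarrow> R.le (\<iota> u) (vR t)"
  using assms(1)
proof (induction t)
  case (Var i)
  then have "agree (Par u \<^bold>\<le> Var i)"
    using assms(2) by (intro agree_singleI[of _ i]) (auto simp: Fm_def tms_def)
  then show ?case by (simp add: agree_le)
next
  case (Par c)
  then have "agree (Par u \<^bold>\<le> Par c)"
    using assms(2) A by (intro agree_singleI[of _ 0]) (auto simp: Fm_def tms_def)
  then show ?case by (simp add: agree_le)
next
  case (Mt t1 t2)
  then have t: "t1 \<in> tms A" "t2 \<in> tms A" by (auto simp: tms_def)
  have u: "Par u \<in> tms V" using assms(2) by (simp add: tms_def)
  show ?case
    using Mt.IH t L.le_mt_iff[OF t(1,2)[THEN tms_A, THEN vL_closed] vL_closed[OF u]]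
      R.le_mt_iff[OF t(1,2)[THEN tms_A, THEN vR_closed] vR_closed[OF u]] by simp
qed

text \<open>A point of \<open>V\<close> strictly below \<open>t\<close> is separated from \<open>t\<close> by another point of \<open>V\<close>, unless it is
  the largest point of \<open>V\<close> below one of the \<open>s i\<close>.\<close>

lemma agree_eq_Par:
  assumes t: "t \<in> tms A" and u: "u \<in> V"
  shows "vL t = u \<longleftrightarrow> vR t = \<iota> u"
proof (cases "u \<in> A")
  case True
  then have "agree (t \<^bold>= Par u)" using t by (intro agree_smallI) (auto simp: Fm_def tms_def)
  then show ?thesis by (simp add: agree_simps)
next
  case False
  \<comment> \<open>A value in \<open>V\<close> of a term over \<open>A\<close> belongs to
    \<open>A\<close>, so equality fails in \<open>M\<close> and has to be refuted in
    \<open>M'\<close>.\<close>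
  then have ne: "vL t \<noteq> u" using A_closed t u by (auto simp: tms_def vL_def)
  have "vR t \<noteq> \<iota> u"
  proof
    assume eq: "vR t = \<iota> u"
    then have lt: "lt M u (vL t)" using agree_Par_le[OF t u] ne by auto
    obtain g where g: "L.le (vL t) (vL g)" "g \<in> Var ` {..<n} \<or> g \<in> Par ` A"
      using generator_above[OF t A] by blast
    have gV: "g \<in> tms V" using g A by (auto simp: tms_def)
    have uV: "Par u \<in> tms V" using u by (simp add: tms_def)
    note cl = vL_closed[OF uV, simplified] vL_closed[OF gV] vL_closed[OF tms_A[OF t]]
    have ug: "lt M u (vL g)" using lt g(1) L.lt_trans[of u "vL t" "vL g"] cl by auto
    \<comment> \<open>If \<open>g\<close> is a variable, then without such a \<open>w\<close> the
      point \<open>u\<close> would be largest in \<open>V\<close> below its value and so belong to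
      \<open>A\<close>. If \<open>g\<close> is a parameter, its value serves as
      \<open>w\<close>.\<close>
    have "\<exists>w\<in>V. L.le w (vL g) \<and> lt M u w"
      using g(2)
    proof
      assume "g \<in> Var ` {..<n}"
      then obtain i where "i < n" "g = Var i" by auto
      then show ?thesis using A_max[OF _ u, of i] False ug by (metis vL_simps(1))
    next
      assume "g \<in> Par ` A"
      then show ?thesis using A ug by (intro bexI[of _ "vL g"]) auto
    qed
    then obtain w where w: "w \<in> V" "L.le w (vL g)" "lt M u w" by blast
    have wV: "Par w \<in> tms V" using w by (simp add: tms_def)
    note cw = vL_closed[OF wV, simplified]
    obtain b where b: "b \<in> basic" "same (t \<^bold>\<sqinter> Par w) b" using small_meet_Par_basic[OF t w(1)] by blast
    \<comment> \<open>Both \<open>t\<close> and \<open>w\<close> lie below \<open>g\<close>, so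
      \<open>t \<sqinter> w\<close> is one of the two, and either way lies strictly above
      \<open>u\<close>.\<close>
    have "L.le (vL t) w \<or> L.le w (vL t)"
      using L.le_linear[of "vL t" w "vL g"] cl cw g(1) w(2) by blast
    then have "mt M (vL t) w = vL t \<or> mt M (vL t) w = w"
      using L.mt_absorb L.mt_commute cl cw by metis
    then have "lt M u (vL b)" using b(2) lt w(3) by (auto simp: same_def)
    \<comment> \<open>By agreement of basic terms this meet lies strictly above \<open>u\<close> in
      \<open>M'\<close> as well, yet it lies below \<open>t\<close>, which is assumed equal to
      \<open>u\<close> there.\<close>
    moreover have "agree (Par u \<^bold>< b)" using basic_agree b u by (auto simp: basic_def)
    ultimately have "lt M' (\<iota> u) (vR b)" by (simp add: agree_simps)
    moreover have "R.le (vR b) (\<iota> u)"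
      using b(2) R.mt_le1[of "vR t" "\<iota> w"] vR_closed tms_A[OF t] range_\<iota> eq by (auto simp: same_def)
    ultimately show False
      using R.lt_trans R.lt_irrefl vR_closed[OF basic_tms[OF b(1)]] vR_closed[OF uV, unfolded vR_simps]
      by metis
  qed
  with ne show ?thesis by simp
qed

text \<open>The inequality says \<open>t \<sqinter> u = t\<close>. The meet is basic: a term over
  \<open>A\<close>, compared with \<open>t\<close> by the small type, or a point of
  \<open>V\<close>, compared by \<open>agree_eq_Par\<close>.\<close>

lemma agree_le_Par:
  assumes t: "t \<in> tms A" and u: "u \<in> V"
  shows "L.le (vL t) u \<longleftrightarrow> R.le (vR t) (\<iota> u)"
proof -
  have uV: "Par u \<in> tms V" using u by (simp add: tms_def)
  obtain b where b: "b \<in> basic" "same (t \<^bold>\<sqinter> Par u) b" using small_meet_Par_basic[OF t u] by blast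
  have "agree (b \<^bold>= t)"
    using basic_cases2[OF b(1)]
  proof
    assume "b \<in> tms A"
    then show ?thesis using t by (intro agree_smallI) (auto simp: Fm_def tms_def)
  next
    assume "\<exists>w\<in>V. b = Par w"
    then show ?thesis using agree_eq_Par[OF t] by (metis agree_simps(1) vL_simps(2) vR_simps(2))
  qed
  then show ?thesis
    using b(2) L.le_iff_mt[OF vL_closed[OF tms_A[OF t]] vL_closed[OF uV]]
      R.le_iff_mt[OF vR_closed[OF tms_A[OF t]] vR_closed[OF uV]] by (simp add: agree_simps same_def)
qed

lemma agree_rel_Par:
  assumes j: "j \<in> J" and t: "t \<in> tms A" and u: "u \<in> V"
  shows "agree (Rel j t (Par u))" "agree (Rel j (Par u) t)"
proof -
  have uV: "Par u \<in> tms V" using u by (simp add: tms_def)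
  obtain g where g: "L.le (vL t) (vL g)" "R.le (vR t) (vR g)" "g \<in> Var ` {..<n} \<or> g \<in> Par ` A"
    using generator_above[OF t A] by blast
  have gV: "g \<in> tms V" using g A by (auto simp: tms_def)
  have "\<exists>i. fv_tm g \<subseteq> {i} \<inter> {..<n}" using g(3) by auto
  then obtain i where i: "fv_tm g \<subseteq> {i} \<inter> {..<n}" by blast
  have ag: "agree (Rel j g (Par u))" "agree (Rel j (Par u) g)"
    using gV u i j by (auto intro!: agree_singleI[of _ i] simp: Fm_def tms_def)
  note cL = vL_closed[OF tms_A[OF t]] vL_closed[OF uV, simplified] vL_closed[OF gV]
  note cR = vR_closed[OF tms_A[OF t]] vR_closed[OF uV, simplified] vR_closed[OF gV]
  have "(rel M j (vL t) u \<longleftrightarrow> rel M' j (vR t) (\<iota> u)) \<and> (rel M j u (vL t) \<longleftrightarrow> rel M' j (\<iota> u) (vR t))"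
  proof (cases "L.le u (vL t) \<or> L.le (vL t) u")
    case True
    \<comment> \<open>Comparability transfers, and between comparable points the relation fails on
      both sides.\<close>
    then have "R.le (\<iota> u) (vR t) \<or> R.le (vR t) (\<iota> u)"
      using agree_Par_le[OF t u] agree_le_Par[OF t u] by blast
    with True show ?thesis
      using L.rel_parallel[OF j] R.rel_parallel[OF j] cL cR by blast
  next
    case False
    then have nR: "\<not> R.le (vR t) (\<iota> u)" "\<not> R.le (\<iota> u) (vR t)"
      using agree_Par_le[OF t u] agree_le_Par[OF t u] by blast+
    have nL: "\<not> L.le (vL t) u" "\<not> L.le u (vL t)" using False by blast+
    \<comment> \<open>On each side \<open>t\<close> may be replaced by \<open>g\<close>, which has
      at most one variable, so that \<open>ag\<close> applies.\<close>
    show ?thesis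
      using L.rel_above_left[OF j cL g(1) nL] L.rel_above_right[OF j cL g(1) nL]
        R.rel_above_left[OF j cR g(2) nR] R.rel_above_right[OF j cR g(2) nR] ag
      by (simp add: agree_simps)
  qed
  then show "agree (Rel j t (Par u))" "agree (Rel j (Par u) t)" by (simp_all add: agree_simps)
qed

section \<open>From atomic formulas to all formulas\<close>

lemma agree_atomic:
  assumes "t \<in> tms V" "u \<in> tms V"
  shows "agree (t \<^bold>= u)" "agree (t \<^bold>< u)" "j \<in> J \<Longrightarrow> agree (Rel j t u)"
proof -
  obtain t' u' where s: "same t t'" "same u u'"
    and n: "t' \<in> tms A \<or> (\<exists>u\<in>V. t' = Par u)" "u' \<in> tms A \<or> (\<exists>v\<in>V. u' = Par v)"
    using normal_form assms by metis
  have mixed: "agree (t \<^bold>= Par v)" "agree (Par v \<^bold>= t)" "agree (t \<^bold>< Par v)" "agree (Par v \<^bold>< t)"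
    if "t \<in> tms A" "v \<in> V" for t v
  proof -
    have v: "Par v \<in> tms V" using that by (simp add: tms_def)
    show *: "agree (t \<^bold>= Par v)" "agree (Par v \<^bold>= t)"
      using agree_eq_Par[OF that] by (auto simp: agree_simps)
    show "agree (t \<^bold>< Par v)" "agree (Par v \<^bold>< t)"
      using agree_le_Par[OF that] agree_Par_le[OF that] *
        L.lt_irrefl[OF vL_closed[OF v]] R.lt_irrefl[OF vR_closed[OF v]]
      unfolding agree_simps vL_simps vR_simps by metis+
  qed
  have "agree (t' \<^bold>= u') \<and> agree (t' \<^bold>< u') \<and> (j \<in> J \<longrightarrow> agree (Rel j t' u'))"
  proof -
    consider "t' \<in> tms A" "u' \<in> tms A" | v where "v \<in> V" "t' = Par v" "u' \<in> tms A"
      | v where "v \<in> V" "u' = Par v" "t' \<in> tms A"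
      | v w where "v \<in> V" "t' = Par v" "w \<in> V" "u' = Par w"
      using n by blast
    then show ?thesis
    proof cases
      case 1
      then show ?thesis by (auto intro!: agree_smallI simp: Fm_def tms_def)
    next
      case 2
      then show ?thesis using mixed agree_rel_Par by blast
    next
      case 3
      then show ?thesis using mixed agree_rel_Par by blast
    next
      case 4
      then show ?thesis by (auto intro!: agree_singleI[of _ 0] simp: Fm_def)
    qed
  qed
  then show "agree (t \<^bold>= u)" "agree (t \<^bold>< u)" "j \<in> J \<Longrightarrow> agree (Rel j t u)"
    using agree_same_eq[OF s] agree_same_lt[OF s] agree_same_rel[OF s] by blast+
qed

lemma agree_prd:
  assumes "t \<in> tms V" "k \<in> K"
  shows "agree (Prd k t)"
proof -
  obtain t' where s: "same t t'" and n: "t' \<in> tms A \<or> (\<exists>u\<in>V. t' = Par u)"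
    using normal_form assms by metis
  have "agree (Prd k t')"
    using n
  proof
    assume "t' \<in> tms A"
    then show ?thesis using assms(2) by (intro agree_smallI) (auto simp: Fm_def tms_def)
  next
    assume "\<exists>u\<in>V. t' = Par u"
    then show ?thesis using assms(2) by (auto intro!: agree_singleI[of _ 0] simp: Fm_def)
  qed
  then show ?thesis using agree_same_prd[OF s] by blast
qed

lemma agree_qfree:
  "qfree \<phi> \<Longrightarrow> \<phi> \<in> Fm J K V \<Longrightarrow> fv \<phi> \<subseteq> {..<n} \<Longrightarrow> agree \<phi>"
proof (induction \<phi>)
  case (Imp \<phi> \<psi>)
  then have "agree \<phi>" "agree \<psi>" by (auto simp: Fm_def)
  then show ?case by (simp add: agree_def)
qed (simp_all add: agree_atomic agree_prd tms_def Fm_def, simp add: agree_def)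

text \<open>Both structures satisfy \<open>T\<close>, so in each of them the formula is equivalent
  to the same quantifier-free one.\<close>

lemma agree_all:
  assumes qe: "eliminates_quantifiers J K T"
    and TL: "\<And>\<sigma> s. \<lbrakk>\<sigma> \<in> T; range s \<subseteq> carrier M\<rbrakk> \<Longrightarrow> sat M id s \<sigma>"
    and TR: "\<And>\<sigma> s. \<lbrakk>\<sigma> \<in> T; range s \<subseteq> carrier M'\<rbrakk> \<Longrightarrow> sat M' \<iota> s \<sigma>"
    and \<phi>: "\<phi> \<in> Fm J K V" "fv \<phi> \<subseteq> {..<n}"
  shows "sat M id s \<phi> \<longleftrightarrow> sat M' \<iota> s' \<phi>"
proof -
  obtain \<rho> \<phi>\<^sub>0 \<psi>\<^sub>0 where eq: "\<phi> = inst \<rho> \<phi>\<^sub>0"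
    and \<psi>: "inst \<rho> \<psi>\<^sub>0 \<in> Fm J K V" "qfree (inst \<rho> \<psi>\<^sub>0)" "fv (inst \<rho> \<psi>\<^sub>0) \<subseteq> fv \<phi>"
    and ran: "ran \<rho> \<subseteq> V" and T: "univ_closure (\<phi>\<^sub>0 \<^bold>\<leftrightarrow> \<psi>\<^sub>0) \<in> T"
    using qe_parameters[OF qe \<phi>(1)] by metis
  have "sat M id s \<phi> \<longleftrightarrow> sat M id s (inst \<rho> \<psi>\<^sub>0)"
    unfolding eq using TL[OF T] range_s ran V by (intro sat_inst_iff) auto
  moreover have "sat M' \<iota> s' \<phi> \<longleftrightarrow> sat M' \<iota> s' (inst \<rho> \<psi>\<^sub>0)"
    unfolding eq using TR[OF T] range_s' range_\<iota> by (intro sat_inst_iff) auto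
  moreover have "agree (inst \<rho> \<psi>\<^sub>0)" using agree_qfree \<psi> \<phi>(2) by blast
  ultimately show ?thesis by (simp add: agree_def)
qed

end


section \<open>Weak binarity\<close>

text \<open>The type contains the formula or its negation, so satisfying the type yields both
  directions. Matching \<open>s\<close> with the tuple only on the free variables lets one
  assignment serve several tuples.\<close>

lemma tp_transfer:
  assumes "\<And>\<psi>. \<psi> \<in> tp J K N k x B \<Longrightarrow> sat M \<iota> s' \<psi>"
    and "\<phi> \<in> Fm J K B" "fv \<phi> \<subseteq> {k..<k + length x}" "\<And>i. i \<in> fv \<phi> \<Longrightarrow> s i = x ! (i - k)"
  shows "sat N id s \<phi> \<longleftrightarrow> sat M \<iota> s' \<phi>"
proof -
  have eq: "sat N id s \<phi> \<longleftrightarrow> sat N id (\<lambda>i. x ! (i - k)) \<phi>"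
    using assms(4) by (intro sat_cong) auto
  have "\<phi> \<in> tp J K N k x B \<or> Neg \<phi> \<in> tp J K N k x B"
    using assms(2,3) by (auto simp: tp_def Fm_def)
  then have "if sat N id s \<phi> then \<phi> \<in> tp J K N k x B else Neg \<phi> \<in> tp J K N k x B"
    unfolding eq by (auto simp: tp_def)
  then show ?thesis using assms(1)[of \<phi>] assms(1)[of "Neg \<phi>"] by (auto split: if_splits)
qed

text \<open>The equation stating that the meet taken in \<open>U\<close> is the meet of
  \<open>u\<close> and \<open>v\<close> stays true in \<open>N\<close>.\<close>

lemma elementary_extension_mt:
  assumes "elementary_extension J K U N" "u \<in> carrier U" "v \<in> carrier U"
  shows "mt N u v \<in> carrier U"
proof -
  let ?w = "mt U u v"
  let ?s = "\<lambda>i. if i = 0 then u else if i = Suc 0 then v else ?w"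
  have w: "?w \<in> carrier U" using assms by (auto simp: elementary_extension_def is_struct_def)
  then have "range ?s \<subseteq> carrier U" using assms by auto
  moreover have "(Var 0 \<^bold>\<sqinter> Var (Suc 0) \<^bold>= Var 2) \<in> Fm J K {}" by (simp add: Fm_def)
  ultimately have "sat U id ?s (Var 0 \<^bold>\<sqinter> Var (Suc 0) \<^bold>= Var 2)
      \<longleftrightarrow> sat N id ?s (Var 0 \<^bold>\<sqinter> Var (Suc 0) \<^bold>= Var 2)"
    using assms(1) unfolding elementary_extension_def by blast
  then show ?thesis using w by simp
qed

text \<open>Coding a term \<open>t\<close> by the formula \<open>t = t\<close> bounds the number of
  values by the number of formulas.\<close>

lemma countable_generated_small:
  fixes N :: "('a, 'j, 'k) struct" and r :: "nat \<Rightarrow> 'a"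
  assumes "|Fm J K {} :: ('a, 'j, 'k) fm set| <o \<kappa>"
  shows "|{u \<in> V. \<exists>t. pars_tm t = {} \<and> u = val N id r t}| <o \<kappa>"
proof -
  define h :: "('a, 'j, 'k) fm \<Rightarrow> 'a" where "h \<phi> = (case \<phi> of t \<^bold>= _ \<Rightarrow> val N id r t)" for \<phi>
  have "val N id r t \<in> h ` Fm J K {}" if "pars_tm t = {}" for t
    using that by (intro image_eqI[of _ _ "t \<^bold>= t"]) (auto simp: h_def Fm_def)
  then have "{u \<in> V. \<exists>t. pars_tm t = {} \<and> u = val N id r t} \<subseteq> h ` Fm J K {}" by blast
  from card_of_mono1[OF this] show ?thesis
    using card_of_image assms ordLeq_transitive ordLeq_ordLess_trans by blast
qed

theorem theorem2p8:
  fixes J :: "'j set" and K :: "'k set"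
    and T :: "('a, 'j, 'k) fm set"
    and \<kappa> :: "'d rel"
    and U N :: "('a, 'j, 'k) struct"
    and a b :: "'a list"
  assumes "binary_cone_expansion J K T"
    and "monster_model J K T \<kappa> U"
    and "elementary_extension J K U N"
    and "set a \<subseteq> carrier N" and "set b \<subseteq> carrier N"
    and "invariant J K \<kappa> U (tp J K N 0 a (carrier U))"
    and "invariant J K \<kappa> U (tp J K N (length a) b (carrier U))"
  shows "\<exists>A. A \<subseteq> carrier U \<and> |A| <o \<kappa> \<and>
    (\<forall>\<phi> \<in> tp J K N 0 (a @ b) (carrier U).
       tp J K N 0 a (carrier U) \<union> tp J K N (length a) b (carrier U) \<union> tp J K N 0 (a @ b) A \<turnstile> \<phi>)"
proof -
  have T: "T \<subseteq> Sent J K {}" "DMT \<subseteq> T" "\<And>j. j \<in> J \<Longrightarrow> on_open_cones j \<subseteq> T"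
    and qe: "eliminates_quantifiers J K T"
    using assms(1) by (auto simp: binary_cone_expansion_def complete_theory_def)
  have U: "model_of T U" "is_struct U" and \<kappa>: "|Fm J K {} :: ('a, 'j, 'k) fm set| <o \<kappa>"
    using assms(2) by (auto simp: monster_model_def model_of_def)
  have N: "is_struct N" "carrier U \<subseteq> carrier N"
    using assms(3) by (auto simp: elementary_extension_def)
  obtain u\<^sub>0 where u\<^sub>0: "u\<^sub>0 \<in> carrier U" using U(2) by (auto simp: is_struct_def)
  have TN: "sat N id s \<sigma>" if "\<sigma> \<in> T" for \<sigma> s
  proof -
    have \<sigma>: "\<sigma> \<in> Fm J K {}" "fv \<sigma> = {}" "pars \<sigma> = {}" using T(1) that by (auto simp: Sent_def Fm_def)
    have r: "range (\<lambda>_::nat. u\<^sub>0) \<subseteq> carrier U" using u\<^sub>0 by auto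
    then have "sat U id (\<lambda>_. u\<^sub>0) \<sigma>" using U(1) that unfolding model_of_def by blast
    then have "sat N id (\<lambda>_. u\<^sub>0) \<sigma>" using assms(3) \<sigma>(1) r unfolding elementary_extension_def by blast
    then show ?thesis using sat_cong[of \<sigma> id id s "\<lambda>_. u\<^sub>0" N] \<sigma> by auto
  qed
  interpret N: cone_tree N J
    using cone_tree_of_DMT[OF N(1) TN T(2,3)] .
  define n where "n = length (a @ b)"
  define x where "x i = (a @ b) ! i" for i
  have x: "x i \<in> carrier N" if "i < n" for i
    using that assms(4,5) nth_mem[of i "a @ b"] by (auto simp: n_def x_def)
  \<comment> \<open>\<open>c i\<close> produces the new point below \<open>x i\<close> if there is
    one, and is arbitrary otherwise.\<close>
  have "\<exists>c. c \<in> carrier U \<and> ((\<exists>u\<in>carrier U. mt N (x i) u \<notin> carrier U) \<longrightarrow> mt N (x i) c \<notin> carrier U)" for i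
    using u\<^sub>0 by blast
  then obtain c where c: "\<And>i. c i \<in> carrier U"
    "\<And>i u. u \<in> carrier U \<Longrightarrow> mt N (x i) u \<notin> carrier U \<Longrightarrow> mt N (x i) (c i) \<notin> carrier U" by metis
  \<comment> \<open>The points below \<open>x i\<close> form a chain, so a maximal point of
    \<open>U\<close> among them is unique; \<open>m i\<close> names it, with a default where none
    exists.\<close>
  define max where "max i w \<longleftrightarrow> w \<in> carrier U \<and> N.le w (x i) \<and>
    (\<forall>u\<in>carrier U. N.le u (x i) \<longrightarrow> \<not> lt N w u)" for i w
  have max_unique: "w = w'" if "max i w" "max i w'" "i < n" for i w w'
  proof -
    have "w \<in> carrier N" "w' \<in> carrier N" "N.le w (x i)" "N.le w' (x i)"
      using that N(2) by (auto simp: max_def)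
    then have "N.le w w' \<or> N.le w' w" using N.le_linear x[OF that(3)] by blast
    then show ?thesis using that by (auto simp: max_def)
  qed
  have "\<exists>m. m \<in> carrier U \<and> (\<forall>w. max i w \<longrightarrow> i < n \<longrightarrow> m = w)" for i
    using u\<^sub>0 max_unique by (metis max_def)
  then obtain m where m: "\<And>i. m i \<in> carrier U" "\<And>i w. max i w \<Longrightarrow> i < n \<Longrightarrow> m i = w" by metis
  \<comment> \<open>One assignment lists the tuple, then the points \<open>c\<close>, then from
    index \<open>n + n\<close> on the points \<open>m\<close>, so that terms without parameters can
    refer to all of them.\<close>
  define r where "r i = (if i < n then x i else if i < n + n then c (i - n) else m (i - (n + n)))" for i
  have r: "range r \<subseteq> carrier N" using x c(1) m(1) N(2) by (auto simp: r_def)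
  define A where "A = {u \<in> carrier U. \<exists>t. pars_tm t = {} \<and> u = val N id r t}"
  have Var_A: "r i \<in> A" if "r i \<in> carrier U" for i
    using that by (auto simp: A_def intro!: exI[of _ "Var i"])
  \<comment> \<open>Each parameter from \<open>A\<close> can be replaced by a parameter-free term
    that produces it.\<close>
  have A_closed: "val N id r t \<in> A" if "pars_tm t \<subseteq> A" "val N id r t \<in> carrier U" for t
  proof -
    have "\<exists>t'. pars_tm t' = {} \<and> val N id r t = val N id r t'"
      using that(1)
    proof (induction t)
      case (Var i)
      show ?case by (intro exI[of _ "Var i"]) auto
    next
      case (Par c)
      then show ?case by (auto simp: A_def id_def)
    next
      case (Mt t1 t2)
      then obtain t1' t2' where "pars_tm t1' = {}" "val N id r t1 = val N id r t1'"
        "pars_tm t2' = {}" "val N id r t2 = val N id r t2'" by (auto simp: id_def)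
      then show ?case by (intro exI[of _ "t1' \<^bold>\<sqinter> t2'"]) (simp add: id_def)
    qed
    then show ?thesis using that(2) by (auto simp: A_def)
  qed
  have "tp J K N 0 a (carrier U) \<union> tp J K N (length a) b (carrier U) \<union> tp J K N 0 (a @ b) A \<turnstile> \<phi>"
    if \<phi>: "\<phi> \<in> tp J K N 0 (a @ b) (carrier U)" for \<phi>
    unfolding entails_def
  proof (intro allI impI, elim conjE)
    fix M :: "(('a, 'j, 'k) fm, 'j, 'k) struct" and \<iota> s
    assume M: "is_struct M" and \<iota>: "range \<iota> \<subseteq> carrier M" and s: "range s \<subseteq> carrier M"
      and sat: "\<forall>\<psi>\<in>tp J K N 0 a (carrier U) \<union> tp J K N (length a) b (carrier U)
        \<union> tp J K N 0 (a @ b) A. sat M \<iota> s \<psi>"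
    have tp_a: "sat N id r \<psi> \<longleftrightarrow> sat M \<iota> s \<psi>"
      if "\<psi> \<in> Fm J K (carrier U)" "fv \<psi> \<subseteq> {..<length a}" for \<psi>
      using sat that by (intro tp_transfer[of J K N 0 a "carrier U"]) (auto simp: r_def x_def n_def nth_append)
    have tp_b: "sat N id r \<psi> \<longleftrightarrow> sat M \<iota> s \<psi>"
      if "\<psi> \<in> Fm J K (carrier U)" "fv \<psi> \<subseteq> {length a..<n}" for \<psi>
    proof (rule tp_transfer[of J K N "length a" b "carrier U"])
      show "r i = b ! (i - length a)" if "i \<in> fv \<psi>" for i
        using that \<open>fv \<psi> \<subseteq> {length a..<n}\<close> by (auto simp: r_def x_def nth_append)
    qed (use sat that in \<open>auto simp: n_def\<close>)
    \<comment> \<open>A sentence of \<open>T\<close> has no free variables, so the type of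
      \<open>a\<close> already decides it, and \<open>M\<close> satisfies \<open>T\<close>.\<close>
    have TM: "sat M \<iota> s' \<sigma>" if "\<sigma> \<in> T" for \<sigma> s'
    proof -
      have \<sigma>: "\<sigma> \<in> Fm J K (carrier U)" "fv \<sigma> = {}" using T(1) that by (auto simp: Sent_def Fm_def)
      then have "sat M \<iota> s \<sigma>" using tp_a TN[OF that] by blast
      then show ?thesis using sat_cong[of \<sigma> \<iota> \<iota> s s' M] \<sigma>(2) by auto
    qed
    interpret M: cone_tree M J
      using cone_tree_of_DMT[OF M TM T(2,3)] .
    interpret agreement N M J K \<iota> r s n "carrier U" A
    proof
      show "mt N u v \<in> carrier U" if "u \<in> carrier U" "v \<in> carrier U" for u v
        using elementary_extension_mt[OF assms(3) that] .
      show "A \<subseteq> carrier U" by (auto simp: A_def)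
      show "sat N id r \<psi> \<longleftrightarrow> sat M \<iota> s \<psi>"
        if "\<psi> \<in> Fm J K (carrier U)" "fv \<psi> \<subseteq> {i} \<inter> {..<n}" for \<psi> i
        \<comment> \<open>A single variable belongs to \<open>a\<close> or to \<open>b\<close>, so
          one of the two given types decides the formula.\<close>
        using tp_a[OF that(1)] tp_b[OF that(1)] that(2) by (cases "i < length a") force+
      show "sat N id r \<psi> \<longleftrightarrow> sat M \<iota> s \<psi>" if "\<psi> \<in> Fm J K A" "fv \<psi> \<subseteq> {..<n}" for \<psi>
        using sat that by (intro tp_transfer[of J K N 0 "a @ b" A]) (auto simp: r_def x_def n_def)
      show "val N id r t \<in> A" if "pars_tm t \<subseteq> A" "val N id r t \<in> carrier U" for t
        using A_closed[OF that] .
      show "\<exists>d\<in>A. mt N (r i) d \<notin> carrier U"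
        if "i < n" "u \<in> carrier U" "mt N (r i) u \<notin> carrier U" for i u
      proof (rule bexI)
        show "r (n + i) \<in> A" using that c(1) by (intro Var_A) (simp add: r_def)
        show "mt N (r i) (r (n + i)) \<notin> carrier U" using that c(2)[of u i] by (simp add: r_def)
      qed
      show "w \<in> A" if "i < n" "w \<in> carrier U" "N.le w (r i)"
        and "\<And>u. \<lbrakk>u \<in> carrier U; N.le u (r i)\<rbrakk> \<Longrightarrow> \<not> lt N w u" for i w
      proof -
        have "max i w" unfolding max_def using that by (simp add: r_def)
        \<comment> \<open>Index \<open>n + n + i\<close> is where \<open>r\<close> holds
          \<open>m i\<close>.\<close>
        then have "r (n + n + i) = w" using m(2) that(1) by (simp add: r_def)
        then show ?thesis using Var_A that(2) by metis
      qed
    qed (use N r s M \<iota> in auto)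
    have "\<phi> \<in> Fm J K (carrier U)" "fv \<phi> \<subseteq> {..<n}" "sat N id x \<phi>"
      using \<phi> by (auto simp: tp_def n_def x_def[abs_def])
    moreover from this have "r i = x i" if "i \<in> fv \<phi>" for i
      using that by (auto simp: r_def)
    then have "sat N id r \<phi>"
      using sat_cong[of \<phi> id id r x N] \<open>sat N id x \<phi>\<close> by simp
    ultimately show "sat M \<iota> s \<phi>" using agree_all[OF qe TN TM] by blast
  qed
  moreover have "|A| <o \<kappa>" unfolding A_def by (rule countable_generated_small[OF \<kappa>])
  moreover have "A \<subseteq> carrier U" by (auto simp: A_def)
  ultimately show ?thesis by blast
qed

end
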